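(* Let $f:[0,\infty)\to[0,\infty)$ be nondecreasing and lower semicontinuous with $f(s)\le Ks^p$ for all $s\ge0$, for some constants $K>0$, $p>0$. Let $\Omega\subset\mathbb{R}^n$ be a bounded open domain with slab diameter $d$, $c=d^2/8$, and let $h,\lambda\in L^\infty(\Omega)$ with $h\ge0$, $\lambda\ge0$, $\Lambda=\|\lambda\|_\infty$. Consider the problem $-\Delta u=\lambda(x)f(u)+h(x)$ in $\Omega$, $u=0$ on $\partial\Omega$. (i) If $p<1$, the problem has a weak solution $u\in W^{1,2}_0(\Omega)\cap L^\infty(\Omega)$, $u\ge0$. (ii) If $p\ge1$ and $cK\Lambda\le\frac12$ and $\|h\|_\infty\le\Lambda K$, the problem has a weak solution $u\in W^{1,2}_0(\Omega)\cap L^\infty(\Omega)$, $u\ge 0$, with $\|u\|_\infty\le1$.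
   Context: Standing assumption: domains are $C^{1,1}$. The slab diameter $d(\Omega)$ is the infimum of the distances between two parallel hyperplanes such that $\Omega$ lies in the region between them. A weak solution of $-\Delta u=\lambda f(u)+h$ in a bounded $\Omega$ with $u=0$ on $\partial\Omega$ is a $u\in W^{1,2}_0(\Omega)$ with $\int_\Omega\nabla u\cdot\nabla\varphi\,dx=\int_\Omega(\lambda f(u)+h)\varphi\,dx$ for all $\varphi\in C_c^\infty(\Omega)$. *)

theory Defs
  imports "HOL-Analysis.Analysis"
begin

fun iter_partial :: "'a::euclidean_space list \<Rightarrow> ('a \<Rightarrow> real) \<Rightarrow> 'a \<Rightarrow> real" where
  "iter_partial [] f = f"
| "iter_partial (d # ds) f = (\<lambda>x. frechet_derivative (iter_partial ds f) (at x) d)"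

definition smooth_fun :: "('a::euclidean_space \<Rightarrow> real) \<Rightarrow> bool" where
  "smooth_fun f \<longleftrightarrow> (\<forall>ds. set ds \<subseteq> Basis \<longrightarrow> (\<forall>x. iter_partial ds f differentiable (at x)))"

definition test_fun :: "'a::euclidean_space set \<Rightarrow> ('a \<Rightarrow> real) \<Rightarrow> bool" where
  "test_fun \<Omega> \<phi> \<longleftrightarrow> smooth_fun \<phi> \<and> compact (closure {x. \<phi> x \<noteq> 0}) \<and> closure {x. \<phi> x \<noteq> 0} \<subseteq> \<Omega>"

definition grad :: "('a::euclidean_space \<Rightarrow> real) \<Rightarrow> 'a \<Rightarrow> 'a" where
  "grad \<phi> x = (\<Sum>i\<in>Basis. frechet_derivative \<phi> (at x) i *\<^sub>R i)"

definition L2_on :: "'a::euclidean_space set \<Rightarrow> ('a \<Rightarrow> 'b::euclidean_space) \<Rightarrow> bool" where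
  "L2_on \<Omega> u \<longleftrightarrow> u \<in> borel_measurable (restrict_space lebesgue \<Omega>)
      \<and> set_integrable lebesgue \<Omega> (\<lambda>x. (norm (u x))\<^sup>2)"

definition Linf_on :: "'a::euclidean_space set \<Rightarrow> ('a \<Rightarrow> real) \<Rightarrow> bool" where
  "Linf_on \<Omega> u \<longleftrightarrow> u \<in> borel_measurable (restrict_space lebesgue \<Omega>)
      \<and> (\<exists>M. AE x in lebesgue. x \<in> \<Omega> \<longrightarrow> \<bar>u x\<bar> \<le> M)"

definition Linf_norm :: "'a::euclidean_space set \<Rightarrow> ('a \<Rightarrow> real) \<Rightarrow> real" where
  "Linf_norm \<Omega> u = Inf {M. AE x in lebesgue. x \<in> \<Omega> \<longrightarrow> \<bar>u x\<bar> \<le> M}"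

definition weak_grad :: "'a::euclidean_space set \<Rightarrow> ('a \<Rightarrow> real) \<Rightarrow> ('a \<Rightarrow> 'a) \<Rightarrow> bool" where
  "weak_grad \<Omega> u g \<longleftrightarrow>
     (\<forall>\<phi>. test_fun \<Omega> \<phi> \<longrightarrow>
        set_integrable lebesgue \<Omega> (\<lambda>x. u x *\<^sub>R grad \<phi> x)
      \<and> set_integrable lebesgue \<Omega> (\<lambda>x. \<phi> x *\<^sub>R g x)
      \<and> (LINT x:\<Omega>|lebesgue. u x *\<^sub>R grad \<phi> x) = - (LINT x:\<Omega>|lebesgue. \<phi> x *\<^sub>R g x))"

definition W120 :: "'a::euclidean_space set \<Rightarrow> ('a \<Rightarrow> real) \<Rightarrow> ('a \<Rightarrow> 'a) \<Rightarrow> bool" where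
  "W120 \<Omega> u g \<longleftrightarrow> L2_on \<Omega> u \<and> L2_on \<Omega> g \<and> weak_grad \<Omega> u g
     \<and> (\<exists>\<phi>s::nat \<Rightarrow> 'a \<Rightarrow> real. (\<forall>k. test_fun \<Omega> (\<phi>s k))
          \<and> (\<lambda>k. LINT x:\<Omega>|lebesgue. (\<phi>s k x - u x)\<^sup>2) \<longlonglongrightarrow> 0
          \<and> (\<lambda>k. LINT x:\<Omega>|lebesgue. (norm (grad (\<phi>s k) x - g x))\<^sup>2) \<longlonglongrightarrow> 0)"

definition weak_solution ::
  "'a::euclidean_space set \<Rightarrow> ('a \<Rightarrow> real) \<Rightarrow> (real \<Rightarrow> real) \<Rightarrow> ('a \<Rightarrow> real) \<Rightarrow> ('a \<Rightarrow> real) \<Rightarrow> bool" where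
  "weak_solution \<Omega> lam f h u \<longleftrightarrow>
     (\<exists>g. W120 \<Omega> u g \<and>
        (\<forall>\<phi>. test_fun \<Omega> \<phi> \<longrightarrow>
           set_integrable lebesgue \<Omega> (\<lambda>x. g x \<bullet> grad \<phi> x)
         \<and> set_integrable lebesgue \<Omega> (\<lambda>x. (lam x * f (u x) + h x) * \<phi> x)
         \<and> (LINT x:\<Omega>|lebesgue. g x \<bullet> grad \<phi> x)
             = (LINT x:\<Omega>|lebesgue. (lam x * f (u x) + h x) * \<phi> x)))"

definition slab_diam :: "'a::euclidean_space set \<Rightarrow> real" where
  "slab_diam \<Omega> = Inf {b2 - b1 | a b1 b2. norm a = 1 \<and> \<Omega> \<subseteq> {x. b1 \<le> a \<bullet> x \<and> a \<bullet> x \<le> b2}}"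

definition C11_fun :: "('a::euclidean_space \<Rightarrow> real) \<Rightarrow> bool" where
  "C11_fun \<gamma> \<longleftrightarrow> (\<forall>x. \<gamma> differentiable (at x))
     \<and> (\<exists>L. \<forall>y z. onorm (\<lambda>v. frechet_derivative \<gamma> (at y) v - frechet_derivative \<gamma> (at z) v) \<le> L * norm (y - z))"

(* C^{1,1} domain: near each boundary point, \<Omega> is the subgraph of a C^{1,1}
   function in suitable orthonormal coordinates (unit direction e, graph over e\<^sup>\<bottom>) *)
definition C11_domain :: "'a::euclidean_space set \<Rightarrow> bool" where
  "C11_domain \<Omega> \<longleftrightarrow> (\<forall>p\<in>frontier \<Omega>. \<exists>e r \<gamma>. norm e = 1 \<and> r > 0 \<and> C11_fun \<gamma> \<and>
       \<Omega> \<inter> ball p r = {x \<in> ball p r. e \<bullet> x < \<gamma> (x - (e \<bullet> x) *\<^sub>R e)})"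

definition lsc_nonneg :: "(real \<Rightarrow> real) \<Rightarrow> bool" where
  "lsc_nonneg f \<longleftrightarrow> (\<forall>s\<ge>0. \<forall>\<epsilon>>0. \<exists>\<delta>>0. \<forall>t\<ge>0. \<bar>t - s\<bar> < \<delta> \<longrightarrow> f s - \<epsilon> < f t)"

end

theory Submission
  imports Defs
begin

text \<open>
  The solution is the limit of the monotone iteration \<open>-\<Delta>u\<^sub>n\<^sub>+\<^sub>1 = \<lambda> f(u\<^sub>n) + h\<close> started at
  \<open>u\<^sub>0 = 0\<close>. Every linear problem is solved by minimising the Dirichlet energy over test
  functions. The iterates increase by the weak comparison principle, and they stay below a
  constant \<open>B\<close> by comparison with the quadratic barrier
  \<open>A/2 (b\<^sub>2 - a \<bullet> x)(a \<bullet> x - b\<^sub>1)\<close> of a slab containing the domain, as soon as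
  \<open>d\<^sup>2/8 (\<Lambda> f(B) + \<parallel>h\<parallel>) \<le> B\<close>. A nondecreasing lower semicontinuous \<open>f\<close> is left continuous, so
  \<open>f(u\<^sub>n)\<close> converges to \<open>f(u)\<close> along the increasing sequence, and the \<open>L\<^sup>2\<close> stability of the
  linear problem identifies the limit as a weak solution.

  Positive parts of test functions are replaced by the smooth function \<open>s exp(-\<epsilon>/s)\<close>, which
  vanishes for \<open>s \<le> 0\<close>, has slope between 0 and 1, and differs from \<open>s\<^sup>+\<close> by at most \<open>\<epsilon>\<close>;
  in this way all truncations are again test functions.
\<close>

section \<open>Smooth functions\<close>

text \<open>Membership in \<open>W120\<close> is accessible only through approximating test
  functions, and the positive part of a Sobolev function is never differentiated. The comparison
  principle is therefore run on the approximants: the truncated difference of two approximants is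
  the admissible test function, and the error of replacing their gradients by the limits g and g'
  tends to zero. The barrier need not vanish on the boundary of \<Omega>; it is only nonnegative on
  \<Omega>. That suffices, because a test function minus the barrier is nonpositive off the support
  of the test function, so its truncation still has compact support. The function f may jump. Hence
  the iteration has to reach its limit from below; a decreasing iteration would call for right
  continuity instead. All estimates are between squared L2 norms and use Young's inequality with a
  chosen weight, so that no square root of an integral ever appears.\<close>

primrec k_smooth :: "nat \<Rightarrow> ('a::euclidean_space \<Rightarrow> real) \<Rightarrow> bool" where
  "k_smooth 0 f \<longleftrightarrow> (\<forall>x. f differentiable (at x))"
| "k_smooth (Suc k) f \<longleftrightarrow> (\<forall>x. f differentiable (at x)) \<and>
     (\<forall>i\<in>Basis. k_smooth k (\<lambda>x. frechet_derivative f (at x) i))"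

lemma iter_partial_snoc:
  "iter_partial (ds @ [d]) f = iter_partial ds (\<lambda>x. frechet_derivative f (at x) d)"
  by (induction ds) auto

text \<open>\<open>iter_partial\<close> applies the head of the list last, so its recursion hides
  the derivative that is taken first. \<open>k_smooth\<close> exposes exactly that one, which is the
  derivative that the product and chain rules compute. Peeling the list from its end matches the
  two.\<close>

lemma k_smooth_iff_iter_partial:
  "k_smooth k f \<longleftrightarrow> (\<forall>ds. set ds \<subseteq> Basis \<and> length ds \<le> k \<longrightarrow>
     (\<forall>x. iter_partial ds f differentiable (at x)))"
proof (induction k arbitrary: f)
  case 0
  then show ?case by auto
next
  case (Suc k)
  show ?case
  proof (intro iffI allI impI)
    fix ds :: "'a list" and x
    assume *: "k_smooth (Suc k) f" "set ds \<subseteq> Basis \<and> length ds \<le> Suc k"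
    show "iter_partial ds f differentiable (at x)"
    proof (cases ds rule: rev_cases)
      case Nil
      then show ?thesis using * by simp
    next
      case (snoc es e)
      then have "k_smooth k (\<lambda>x. frechet_derivative f (at x) e)" using * by auto
      then show ?thesis using Suc.IH snoc * by (simp add: iter_partial_snoc)
    qed
  next
    assume *: "\<forall>ds. set ds \<subseteq> Basis \<and> length ds \<le> Suc k \<longrightarrow>
      (\<forall>x. iter_partial ds f differentiable (at x))"
    have "f differentiable (at x)" for x
      using *[rule_format, of "[]"] by simp
    moreover have "k_smooth k (\<lambda>x. frechet_derivative f (at x) i)" if "i \<in> Basis" for i
      unfolding Suc.IH
    proof (intro allI impI)
      fix ds :: "'a list" and x assume "set ds \<subseteq> Basis \<and> length ds \<le> k"
      then show "iter_partial ds (\<lambda>x. frechet_derivative f (at x) i) differentiable (at x)"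
        using *[rule_format, of "ds @ [i]" x] that by (simp add: iter_partial_snoc)
    qed
    ultimately show "k_smooth (Suc k) f" by simp
  qed
qed

lemma smooth_fun_iff_k_smooth: "smooth_fun f \<longleftrightarrow> (\<forall>k. k_smooth k f)"
  unfolding smooth_fun_def k_smooth_iff_iter_partial by blast

lemma k_smooth_Suc_imp: "k_smooth (Suc k) f \<Longrightarrow> k_smooth k f"
  by (auto simp: k_smooth_iff_iter_partial)

lemma k_smooth_differentiable: "k_smooth k f \<Longrightarrow> f differentiable (at x)"
  by (cases k) auto

lemma frechet_derivativeI:
  "(f has_derivative f') (at x) \<Longrightarrow> frechet_derivative f (at x) i = f' i"
  using frechet_derivative_at by metis

lemma k_smooth_const: "k_smooth k (\<lambda>x. c)"
  by (induction k arbitrary: c) auto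

lemma k_smooth_inner: "k_smooth k (\<lambda>x. a \<bullet> x)"
proof (cases k)
  case (Suc l)
  have d: "((\<lambda>x. a \<bullet> x) has_derivative (\<lambda>v. a \<bullet> v)) (at x)" for x
    by (auto intro!: derivative_eq_intros)
  then have "frechet_derivative (\<lambda>x. a \<bullet> x) (at x) = (\<lambda>v. a \<bullet> v)" for x
    by (metis frechet_derivative_at)
  then show ?thesis using Suc d by (auto simp: k_smooth_const differentiable_def)
qed (auto intro!: derivative_intros)

lemma k_smooth_add: "k_smooth k f \<Longrightarrow> k_smooth k g \<Longrightarrow> k_smooth k (\<lambda>x. f x + g x)"
proof (induction k arbitrary: f g)
  case (Suc k)
  have "frechet_derivative (\<lambda>x. f x + g x) (at x) i
      = frechet_derivative f (at x) i + frechet_derivative g (at x) i" for x i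
    using Suc.prems
    by (intro frechet_derivativeI has_derivative_add) (simp_all flip: frechet_derivative_works)
  then show ?case using Suc by (auto intro!: differentiable_add)
qed (auto intro!: differentiable_add)

lemma k_smooth_mult: "k_smooth k f \<Longrightarrow> k_smooth k g \<Longrightarrow> k_smooth k (\<lambda>x. f x * g x)"
proof (induction k arbitrary: f g)
  case (Suc k)
  have "frechet_derivative (\<lambda>x. f x * g x) (at x) i
      = f x * frechet_derivative g (at x) i + frechet_derivative f (at x) i * g x" for x i
    using Suc.prems
    by (intro frechet_derivativeI has_derivative_mult) (simp_all flip: frechet_derivative_works)
  then show ?case using Suc.prems
      k_smooth_Suc_imp[OF Suc.prems(1)] k_smooth_Suc_imp[OF Suc.prems(2)]
    by (auto intro!: differentiable_mult k_smooth_add Suc.IH)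
qed (auto intro!: differentiable_mult)

text \<open>Smoothness is a local property. This is the gluing tool for functions given by different
  formulas on overlapping open sets, as in \<open>test_fun_truncation\<close>.\<close>

lemma k_smooth_local:
  assumes "\<And>x. \<exists>S g. open S \<and> x \<in> S \<and> k_smooth k g \<and> (\<forall>y\<in>S. f y = g y)"
  shows "k_smooth k f"
  using assms
proof (induction k arbitrary: f)
  case 0
  show ?case unfolding k_smooth.simps
  proof
    fix x
    obtain S g where S: "open S" "x \<in> S" "k_smooth 0 g" "\<forall>y\<in>S. f y = g y"
      using 0 by meson
    then obtain D where "(g has_derivative D) (at x)" by (auto simp: differentiable_def)
    then have "(f has_derivative D) (at x)"
      using S by (auto elim!: has_derivative_transform_within_open)
    then show "f differentiable at x" by (auto simp: differentiable_def)
  qed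
next
  case (Suc k)
  \<comment> \<open>On the open set S the derivatives of f and g coincide at every point, so the
    partial derivatives of f satisfy the local hypothesis again, with one order less.\<close>
  have *: "\<exists>S g. open S \<and> x \<in> S \<and> k_smooth (Suc k) g \<and> (\<forall>y\<in>S. f y = g y) \<and>
    (\<forall>y\<in>S. f differentiable at y \<and> frechet_derivative f (at y) = frechet_derivative g (at y))" for x
  proof -
    obtain S g where S: "open S" "x \<in> S" "k_smooth (Suc k) g" "\<forall>y\<in>S. f y = g y"
      using Suc.prems by meson
    have "(f has_derivative frechet_derivative g (at y)) (at y)" if "y \<in> S" for y
    proof -
      have "(g has_derivative frechet_derivative g (at y)) (at y)"
        using S by (simp flip: frechet_derivative_works)
      then show ?thesis
        using S that by (auto elim!: has_derivative_transform_within_open)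
    qed
    then show ?thesis
      using S by (metis differentiableI frechet_derivative_at)
  qed
  have "f differentiable at x" for x using * by meson
  moreover have "k_smooth k (\<lambda>x. frechet_derivative f (at x) i)" if "i \<in> Basis" for i
  proof (rule Suc.IH)
    fix x
    obtain S g where "open S" "x \<in> S" "k_smooth (Suc k) g"
      "\<forall>y\<in>S. frechet_derivative f (at y) = frechet_derivative g (at y)"
      using * by meson
    then show "\<exists>S g. open S \<and> x \<in> S \<and> k_smooth k g \<and> (\<forall>y\<in>S. frechet_derivative f (at y) i = g y)"
      using that by (intro exI[of _ S] exI[of _ "\<lambda>y. frechet_derivative g (at y) i"]) auto
  qed
  ultimately show ?case by simp
qed

lemma smooth_fun_differentiable: "smooth_fun f \<Longrightarrow> f differentiable (at x)"
  by (auto simp: smooth_fun_iff_k_smooth intro: k_smooth_differentiable)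

lemma smooth_fun_partial:
  "smooth_fun f \<Longrightarrow> i \<in> Basis \<Longrightarrow> smooth_fun (\<lambda>x. frechet_derivative f (at x) i)"
  unfolding smooth_fun_iff_k_smooth by (metis k_smooth.simps(2))

lemma smooth_fun_const: "smooth_fun (\<lambda>x. c)"
  by (simp add: smooth_fun_iff_k_smooth k_smooth_const)

lemma smooth_fun_inner: "smooth_fun (\<lambda>x. a \<bullet> x)"
  by (simp add: smooth_fun_iff_k_smooth k_smooth_inner)

lemma smooth_fun_add: "smooth_fun f \<Longrightarrow> smooth_fun g \<Longrightarrow> smooth_fun (\<lambda>x. f x + g x)"
  by (simp add: smooth_fun_iff_k_smooth k_smooth_add)

lemma smooth_fun_mult: "smooth_fun f \<Longrightarrow> smooth_fun g \<Longrightarrow> smooth_fun (\<lambda>x. f x * g x)"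
  by (simp add: smooth_fun_iff_k_smooth k_smooth_mult)

lemma smooth_fun_diff: "smooth_fun f \<Longrightarrow> smooth_fun g \<Longrightarrow> smooth_fun (\<lambda>x. f x - g x)"
  using smooth_fun_add[OF _ smooth_fun_mult[OF smooth_fun_const[of "-1"]], of f g] by simp

lemma smooth_fun_local:
  assumes "\<And>x. \<exists>S g. open S \<and> x \<in> S \<and> smooth_fun g \<and> (\<forall>y\<in>S. f y = g y)"
  shows "smooth_fun f"
  unfolding smooth_fun_iff_k_smooth
proof
  fix k
  show "k_smooth k f"
    by (rule k_smooth_local) (use assms in \<open>meson smooth_fun_iff_k_smooth\<close>)
qed

lemma smooth_fun_continuous_on: "smooth_fun f \<Longrightarrow> continuous_on S f"
  by (meson continuous_at_imp_continuous_on differentiable_imp_continuous_within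
      smooth_fun_differentiable)

section \<open>A smooth positive part\<close>

text \<open>The powers of 1/s make the family closed under differentiation: the derivative of member
  n is a combination of members n+1 and n+2. Smoothness of all orders then follows by a single
  induction over all n at once.\<close>

definition flat_exp :: "real \<Rightarrow> nat \<Rightarrow> real \<Rightarrow> real" where
  "flat_exp \<epsilon> n s = (if s > 0 then (1/s) ^ n * exp (- \<epsilon> / s) else 0)"

text \<open>With t = 1/s the right-hand limit becomes that of t^n exp(-\<epsilon> t) at infinity,
  where the exponential beats every power.\<close>

lemma flat_exp_tendsto_0:
  assumes "\<epsilon> > 0"
  shows "((\<lambda>s. flat_exp \<epsilon> n s) \<longlongrightarrow> 0) (at 0)"
proof -
  have "((\<lambda>t. t ^ n / exp (\<epsilon> * t)) \<longlongrightarrow> 0) at_top"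
  proof -
    have "((\<lambda>t. (1/\<epsilon>)^n * ((\<epsilon> * t) ^ n / exp (\<epsilon> * t))) \<longlongrightarrow> (1/\<epsilon>)^n * 0) at_top"
      by (intro tendsto_mult tendsto_const filterlim_compose[OF tendsto_power_div_exp_0]
          filterlim_tendsto_pos_mult_at_top[OF tendsto_const assms] filterlim_ident)
    then show ?thesis
      using assms by (simp add: power_mult_distrib power_divide)
  qed
  then have "((\<lambda>s. inverse s ^ n / exp (\<epsilon> * inverse s)) \<longlongrightarrow> 0) (at_right 0)"
    by (rule filterlim_compose) (rule filterlim_inverse_at_top_right)
  then have "((\<lambda>s. flat_exp \<epsilon> n s) \<longlongrightarrow> 0) (at_right 0)"
    by (rule Lim_transform_eventually)
      (auto simp: eventually_at_right_less flat_exp_def field_simps exp_minus intro!: eventually_mono[OF eventually_at_right_less])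
  moreover have "((\<lambda>s. flat_exp \<epsilon> n s) \<longlongrightarrow> 0) (at_left 0)"
    by (rule tendsto_eventually) (auto simp: flat_exp_def eventually_at_filter)
  ultimately show ?thesis by (simp add: filterlim_at_split)
qed

lemma has_real_derivative_flat_exp:
  assumes "\<epsilon> > 0"
  shows "(flat_exp \<epsilon> n has_real_derivative
           (- real n * flat_exp \<epsilon> (n + 1) s + \<epsilon> * flat_exp \<epsilon> (n + 2) s)) (at s)"
proof -
  consider "s > 0" | "s < 0" | "s = 0" by linarith
  then show ?thesis
  proof cases
    case 1
    have "((\<lambda>s. (1/s) ^ n * exp (- \<epsilon> / s)) has_real_derivative
        - real n * ((1/s) ^ (n+1) * exp (- \<epsilon> / s)) + \<epsilon> * ((1/s) ^ (n+2) * exp (- \<epsilon> / s))) (at s)"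
    proof -
      have "s ^ m = s * s ^ (m - Suc 0)" if "m \<noteq> 0" for m
        using that by (cases m) auto
      note * = this
      show ?thesis
        using 1 by (cases n)
          (auto intro!: derivative_eq_intros simp: field_simps power2_eq_square; metis *)+
    qed
    then have "((\<lambda>s. (1/s) ^ n * exp (- \<epsilon> / s)) has_real_derivative
           (- real n * flat_exp \<epsilon> (n + 1) s + \<epsilon> * flat_exp \<epsilon> (n + 2) s)) (at s)"
      using 1 by (simp add: flat_exp_def)
    then show ?thesis
      by (rule DERIV_cong_ev[THEN iffD1, rotated -1, OF _ refl _ refl])
        (use 1 in \<open>auto simp: flat_exp_def eventually_nhds intro!: exI[of _ "{0<..}"]\<close>)
  next
    case 2
    have "((\<lambda>s. 0) has_real_derivative
           (- real n * flat_exp \<epsilon> (n + 1) s + \<epsilon> * flat_exp \<epsilon> (n + 2) s)) (at s)"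
      using 2 by (simp add: flat_exp_def)
    then show ?thesis
      by (rule DERIV_cong_ev[THEN iffD1, rotated -1, OF _ refl _ refl])
        (use 2 in \<open>auto simp: flat_exp_def eventually_nhds intro!: exI[of _ "{..<0}"]\<close>)
  next
    case 3
    \<comment> \<open>At the origin the difference quotient of member n is member n+1, whose limit
      is already known to be 0.\<close>
    have "((\<lambda>h. (flat_exp \<epsilon> n (0 + h) - flat_exp \<epsilon> n 0) / h) \<longlongrightarrow> 0) (at 0)"
      using flat_exp_tendsto_0[OF assms, of "n + 1"]
      by (rule Lim_transform_eventually) (auto simp: flat_exp_def eventually_at_filter)
    moreover have "- real n * flat_exp \<epsilon> (n + 1) 0 + \<epsilon> * flat_exp \<epsilon> (n + 2) 0 = 0"
      by (simp add: flat_exp_def)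
    ultimately show ?thesis unfolding DERIV_def using 3 by simp
  qed
qed

lemma k_smooth_flat_exp:
  assumes "\<epsilon> > 0"
  shows "k_smooth k f \<Longrightarrow> k_smooth k (\<lambda>x. flat_exp \<epsilon> n (f x))"
proof (induction k arbitrary: n)
  have d: "((\<lambda>x. flat_exp \<epsilon> n (f x)) has_derivative
      (\<lambda>v. (- real n * flat_exp \<epsilon> (n+1) (f x) + \<epsilon> * flat_exp \<epsilon> (n+2) (f x)) *
           frechet_derivative f (at x) v)) (at x)"
    if "f differentiable at x" for x n
  proof -
    from that have "(f has_derivative frechet_derivative f (at x)) (at x)"
      by (simp flip: frechet_derivative_works)
    from has_derivative_compose[OF this
        has_real_derivative_flat_exp[OF assms, unfolded has_field_derivative_def]]
    show ?thesis by (simp add: mult.commute)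
  qed
  {
    case 0
    with d show ?case by (auto simp: differentiable_def)
  next
    case (Suc k)
    have "frechet_derivative (\<lambda>x. flat_exp \<epsilon> n (f x)) (at x) i =
      (- real n * flat_exp \<epsilon> (n+1) (f x) + \<epsilon> * flat_exp \<epsilon> (n+2) (f x)) *
           frechet_derivative f (at x) i" for x i
      using Suc.prems d by (intro frechet_derivativeI) auto
    moreover have "(\<lambda>x. flat_exp \<epsilon> n (f x)) differentiable (at x)" for x
      using d Suc.prems by (force simp: differentiable_def)
    moreover have "k_smooth k (\<lambda>x. (- real n * flat_exp \<epsilon> (n+1) (f x) + \<epsilon> * flat_exp \<epsilon> (n+2) (f x)) *
           frechet_derivative f (at x) i)" if "i \<in> Basis" for i
      using Suc.prems k_smooth_Suc_imp[OF Suc.prems] that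
      by (intro k_smooth_mult k_smooth_add k_smooth_const Suc.IH) auto
    ultimately show ?case by simp
  }
qed

definition smooth_pos :: "real \<Rightarrow> real \<Rightarrow> real" where
  "smooth_pos \<epsilon> s = s * flat_exp \<epsilon> 0 s"

definition smooth_pos' :: "real \<Rightarrow> real \<Rightarrow> real" where
  "smooth_pos' \<epsilon> s = flat_exp \<epsilon> 0 s + \<epsilon> * flat_exp \<epsilon> 1 s"

lemma smooth_fun_smooth_pos:
  "\<epsilon> > 0 \<Longrightarrow> smooth_fun f \<Longrightarrow> smooth_fun (\<lambda>x. smooth_pos \<epsilon> (f x))"
  unfolding smooth_pos_def
  by (intro smooth_fun_mult) (auto simp: smooth_fun_iff_k_smooth k_smooth_flat_exp)

lemma has_real_derivative_smooth_pos:
  assumes "\<epsilon> > 0"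
  shows "(smooth_pos \<epsilon> has_real_derivative smooth_pos' \<epsilon> s) (at s)"
proof -
  have "s * flat_exp \<epsilon> 2 s = flat_exp \<epsilon> 1 s"
    by (simp add: flat_exp_def power2_eq_square)
  then show ?thesis
    unfolding smooth_pos_def smooth_pos'_def
    using has_real_derivative_flat_exp[OF assms, of 0 s]
    by (auto intro!: derivative_eq_intros simp: algebra_simps eval_nat_numeral)
qed

text \<open>With x = \<epsilon>/s the slope is (1 + x) exp(-x), which is at most 1 because 1 + x
  \<le> exp x. The same inequality at -x yields the error bound
  \<open>smooth_pos_ge\<close>.\<close>

lemma smooth_pos'_bounds:
  assumes "\<epsilon> > 0"
  shows "0 \<le> smooth_pos' \<epsilon> s" "smooth_pos' \<epsilon> s \<le> 1"
proof -
  show "0 \<le> smooth_pos' \<epsilon> s"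
    using assms by (auto simp: smooth_pos'_def flat_exp_def)
  have "(1 + \<epsilon> / s) * exp (- \<epsilon> / s) \<le> 1" if "s > 0"
    using exp_ge_add_one_self[of "\<epsilon> / s"] by (simp add: exp_minus field_simps)
  then show "smooth_pos' \<epsilon> s \<le> 1"
    by (auto simp: smooth_pos'_def flat_exp_def algebra_simps)
qed

lemma smooth_pos_nonneg: "0 \<le> smooth_pos \<epsilon> s"
  by (auto simp: smooth_pos_def flat_exp_def)

lemma smooth_pos_eq_0: "s \<le> 0 \<Longrightarrow> smooth_pos \<epsilon> s = 0"
  by (auto simp: smooth_pos_def flat_exp_def)

lemma smooth_pos_ge:
  assumes "\<epsilon> > 0"
  shows "s - \<epsilon> \<le> smooth_pos \<epsilon> s"
proof (cases "s > 0")
  case True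
  have "1 + (- \<epsilon> / s) \<le> exp (- \<epsilon> / s)" by (rule exp_ge_add_one_self)
  then have "s * (1 + (- \<epsilon> / s)) \<le> s * exp (- \<epsilon> / s)"
    using True by (intro mult_left_mono) auto
  then show ?thesis using True by (simp add: smooth_pos_def flat_exp_def algebra_simps)
qed (use assms in \<open>auto simp: smooth_pos_eq_0\<close>)

section \<open>Square-integrable functions\<close>

definition sq_int :: "'x measure \<Rightarrow> ('x \<Rightarrow> 'b::euclidean_space) \<Rightarrow> bool" where
  "sq_int M f \<longleftrightarrow> f \<in> borel_measurable M \<and> integrable M (\<lambda>x. (norm (f x))\<^sup>2)"

abbreviation sq_norm :: "'x measure \<Rightarrow> ('x \<Rightarrow> 'b::euclidean_space) \<Rightarrow> real" where
  "sq_norm M f \<equiv> LINT x|M. (norm (f x))\<^sup>2"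

lemma norm_add_sq_le: "(norm (a + b))\<^sup>2 \<le> 2 * (norm a)\<^sup>2 + 2 * (norm (b::'b::real_inner))\<^sup>2"
proof -
  have "(norm (a + b))\<^sup>2 + (norm (a - b))\<^sup>2 = 2 * (norm a)\<^sup>2 + 2 * (norm b)\<^sup>2"
    by (simp add: power2_norm_eq_inner inner_simps inner_commute)
  then show ?thesis by (smt (verit) zero_le_power2)
qed

text \<open>Young's inequality, from a completed square and Cauchy--Schwarz. The free weight t is
  tuned in each application, either to make two error terms equally small or to absorb one term on
  the left.\<close>

lemma inner_le_weighted:
  fixes a b :: "'b::real_inner"
  assumes "t > 0"
  shows "\<bar>a \<bullet> b\<bar> \<le> t * (norm a)\<^sup>2 + (norm b)\<^sup>2 / (4 * t)"
proof -
  have "0 \<le> (2 * t * norm a - norm b)\<^sup>2 / (4 * t)" using assms by simp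
  then have "norm a * norm b \<le> t * (norm a)\<^sup>2 + (norm b)\<^sup>2 / (4 * t)"
    using assms by (simp add: field_simps power2_eq_square)
  then show ?thesis using Cauchy_Schwarz_ineq2[of a b] by linarith
qed

lemma sq_int_integrable: "sq_int M f \<Longrightarrow> integrable M (\<lambda>x. (norm (f x))\<^sup>2)"
  by (simp add: sq_int_def)

lemma sq_int_bound:
  assumes "f \<in> borel_measurable M" "integrable M g" "AE x in M. (norm (f x))\<^sup>2 \<le> g x"
  shows "sq_int M f"
proof -
  have "integrable M (\<lambda>x. (norm (f x))\<^sup>2)"
    using assms(2) by (rule Bochner_Integration.integrable_bound) (use assms in auto)
  then show ?thesis using assms by (simp add: sq_int_def)
qed

lemma sq_int_add:
  assumes "sq_int M f" "sq_int M g"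
  shows "sq_int M (\<lambda>x. f x + g x)"
proof (rule sq_int_bound)
  show "integrable M (\<lambda>x. 2 * (norm (f x))\<^sup>2 + 2 * (norm (g x))\<^sup>2)"
    using assms by (auto simp: sq_int_def)
qed (use assms norm_add_sq_le in \<open>auto simp: sq_int_def\<close>)

lemma sq_int_scaleR: "sq_int M f \<Longrightarrow> sq_int M (\<lambda>x. c *\<^sub>R f x)"
  by (auto simp: sq_int_def power_mult_distrib)

lemma sq_int_diff: "sq_int M f \<Longrightarrow> sq_int M g \<Longrightarrow> sq_int M (\<lambda>x. f x - g x)"
  using sq_int_add[OF _ sq_int_scaleR[of M g "-1"], of f] by simp

lemma sq_norm_add_le:
  assumes "sq_int M f" "sq_int M g"
  shows "sq_norm M (\<lambda>x. f x + g x) \<le> 2 * sq_norm M f + 2 * sq_norm M g"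
proof -
  have "sq_norm M (\<lambda>x. f x + g x) \<le> (LINT x|M. 2 * (norm (f x))\<^sup>2 + 2 * (norm (g x))\<^sup>2)"
    using assms sq_int_integrable[OF sq_int_add[OF assms]]
    by (intro integral_mono norm_add_sq_le) (auto simp: sq_int_def)
  then show ?thesis using assms by (simp add: sq_int_def)
qed

lemma sq_norm_diff_le:
  assumes "sq_int M f" "sq_int M g"
  shows "sq_norm M (\<lambda>x. f x - g x) \<le> 2 * sq_norm M f + 2 * sq_norm M g"
  using sq_norm_add_le[OF assms(1) sq_int_scaleR[OF assms(2), of "-1"]] by simp

lemma sq_norm_nonneg: "0 \<le> sq_norm M f"
  by simp

lemma integrable_inner_sq_int:
  assumes "sq_int M f" "sq_int M g"
  shows "integrable M (\<lambda>x. f x \<bullet> g x)"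
proof (rule Bochner_Integration.integrable_bound)
  show "integrable M (\<lambda>x. 1 * (norm (f x))\<^sup>2 + (norm (g x))\<^sup>2 / (4 * 1))"
    using assms by (intro Bochner_Integration.integrable_add integrable_mult_right
        integrable_divide_zero) (auto simp: sq_int_def)
  show "(\<lambda>x. f x \<bullet> g x) \<in> borel_measurable M"
    using assms by (auto simp: sq_int_def)
  show "AE x in M. norm (f x \<bullet> g x) \<le> norm (1 * (norm (f x))\<^sup>2 + (norm (g x))\<^sup>2 / (4 * 1))"
    using inner_le_weighted[of 1 "f _" "g _"] by (intro AE_I2) simp
qed

lemma integral_inner_le_weighted:
  assumes "sq_int M f" "sq_int M g" "t > 0"
  shows "\<bar>LINT x|M. f x \<bullet> g x\<bar> \<le> t * sq_norm M f + sq_norm M g / (4 * t)"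
proof -
  have "\<bar>LINT x|M. f x \<bullet> g x\<bar> \<le> (LINT x|M. \<bar>f x \<bullet> g x\<bar>)"
    by (rule integral_abs_bound)
  also have "\<dots> \<le> (LINT x|M. t * (norm (f x))\<^sup>2 + (norm (g x))\<^sup>2 / (4 * t))"
    using assms integrable_inner_sq_int[OF assms(1,2)]
    by (intro integral_mono inner_le_weighted) (auto simp: sq_int_def)
  also have "\<dots> = t * sq_norm M f + sq_norm M g / (4 * t)"
    using assms by (simp add: sq_int_def)
  finally show ?thesis .
qed

text \<open>Strong L2 convergence implies weak convergence; this carries every identity for test
  functions over to their limits.\<close>

lemma tendsto_integral_inner:
  assumes "\<And>k. sq_int M (f k)" "sq_int M f'" "sq_int M g"
    and lim: "(\<lambda>k. sq_norm M (\<lambda>x. f k x - f' x)) \<longlonglongrightarrow> 0"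
  shows "(\<lambda>k. LINT x|M. f k x \<bullet> g x) \<longlonglongrightarrow> (LINT x|M. f' x \<bullet> g x)"
proof (rule LIMSEQ_I)
  fix r :: real assume "r > 0"
  define G where "G = sq_norm M g"
  \<comment> \<open>This weight makes each of the two Young terms at most r/4; the summand 1 keeps
    it positive when G = 0.\<close>
  define t where "t = (G + 1) / r"
  have G: "G \<ge> 0" by (simp add: G_def)
  then have t: "t > 0" using \<open>r > 0\<close> by (simp add: t_def)
  have "\<forall>\<^sub>F k in sequentially. sq_norm M (\<lambda>x. f k x - f' x) < r / (4 * t)"
    using lim t \<open>r > 0\<close> by (intro order_tendstoD) auto
  then obtain N where N: "\<And>k. k \<ge> N \<Longrightarrow> sq_norm M (\<lambda>x. f k x - f' x) < r / (4 * t)"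
    by (auto simp: eventually_sequentially)
  have "norm ((LINT x|M. f k x \<bullet> g x) - (LINT x|M. f' x \<bullet> g x)) < r" if "k \<ge> N" for k
  proof -
    have "(LINT x|M. f k x \<bullet> g x) - (LINT x|M. f' x \<bullet> g x) = (LINT x|M. (f k x - f' x) \<bullet> g x)"
      using assms by (simp add: inner_diff_left integrable_inner_sq_int)
    also have "\<bar>\<dots>\<bar> \<le> t * sq_norm M (\<lambda>x. f k x - f' x) + G / (4 * t)"
      unfolding G_def using assms t by (intro integral_inner_le_weighted sq_int_diff) auto
    also have "t * sq_norm M (\<lambda>x. f k x - f' x) \<le> t * (r / (4 * t))"
      using N[OF that] t by (intro mult_left_mono) auto
    also have "\<dots> = r / 4" using t by simp
    also have "G / (4 * t) \<le> r / 4"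
      using G \<open>r > 0\<close> by (simp add: t_def field_simps)
    finally show ?thesis using \<open>r > 0\<close> by simp
  qed
  then show "\<exists>N. \<forall>k\<ge>N. norm ((LINT x|M. f k x \<bullet> g x) - (LINT x|M. f' x \<bullet> g x)) < r"
    by blast
qed

section \<open>Completeness of L2 on a finite measure space\<close>

context finite_measure
begin

lemma sq_int_bounded:
  assumes "f \<in> borel_measurable M" "AE x in M. norm (f x) \<le> B"
  shows "sq_int M f"
proof (rule sq_int_bound)
  show "AE x in M. (norm (f x))\<^sup>2 \<le> B\<^sup>2"
    using assms(2) by eventually_elim (auto intro: power_mono)
qed (use assms in auto)

lemma sq_int_imp_integrable:
  assumes "sq_int M f"
  shows "integrable M f"
proof (rule Bochner_Integration.integrable_bound)
  show "integrable M (\<lambda>x. 1 + (norm (f x))\<^sup>2)" using assms by (auto simp: sq_int_def)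
  show "AE x in M. norm (f x) \<le> norm (1 + (norm (f x))\<^sup>2)"
  proof (intro AE_I2)
    fix x
    have "0 \<le> (norm (f x) - 1/2)\<^sup>2" by simp
    then show "norm (f x) \<le> norm (1 + (norm (f x))\<^sup>2)"
      by (simp add: power2_eq_square algebra_simps)
  qed
qed (use assms in \<open>auto simp: sq_int_def\<close>)

lemma integral_norm_le_weighted:
  assumes "sq_int M f" "t > 0"
  shows "(LINT x|M. norm (f x)) \<le> t * sq_norm M f + measure M (space M) / (4 * t)"
proof -
  have "sq_int M (\<lambda>x. norm (f x))" using assms by (auto simp: sq_int_def)
  moreover have "sq_int M (\<lambda>x. 1::real)" by (auto simp: sq_int_def)
  ultimately have "\<bar>LINT x|M. norm (f x) \<bullet> 1\<bar> \<le> t * sq_norm M (\<lambda>x. norm (f x)) + sq_norm M (\<lambda>x. 1::real) / (4 * t)"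
    using \<open>t > 0\<close> by (intro integral_inner_le_weighted)
  then show ?thesis by simp
qed

text \<open>On a finite measure space an L2 Cauchy sequence is Cauchy in L1, since the constant 1 is
  square integrable. This gives a subsequence that converges almost everywhere, and Fatou's lemma
  turns its pointwise limit into an L2 limit of the whole sequence.\<close>

lemma sq_int_complete:
  fixes s :: "nat \<Rightarrow> 'a \<Rightarrow> 'b::euclidean_space"
  assumes s: "\<And>n. sq_int M (s n)"
    and cauchy: "\<And>e. e > 0 \<Longrightarrow> \<exists>N. \<forall>i\<ge>N. \<forall>j\<ge>N. sq_norm M (\<lambda>x. s i x - s j x) < e"
  obtains f where "sq_int M f" "(\<lambda>n. sq_norm M (\<lambda>x. s n x - f x)) \<longlonglongrightarrow> 0"
proof -
  have [measurable]: "s n \<in> borel_measurable M" for n using s by (simp add: sq_int_def)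
  have "\<exists>N. \<forall>i\<ge>N. \<forall>j\<ge>N. (LINT x|M. norm (s i x - s j x)) < e" if "e > 0" for e
  proof -
    define m where "m = measure M (space M)"
    define t where "t = (m + 1) / e"
    have m: "m \<ge> 0" by (simp add: m_def)
    have t: "t > 0" using \<open>e > 0\<close> m by (simp add: t_def)
    obtain N where N: "\<And>i j. i \<ge> N \<Longrightarrow> j \<ge> N \<Longrightarrow> sq_norm M (\<lambda>x. s i x - s j x) < e / (4 * t)"
      using cauchy[of "e / (4 * t)"] t \<open>e > 0\<close> by auto
    have "(LINT x|M. norm (s i x - s j x)) < e" if "i \<ge> N" "j \<ge> N" for i j
    proof -
      have "(LINT x|M. norm (s i x - s j x)) \<le> t * sq_norm M (\<lambda>x. s i x - s j x) + m / (4 * t)"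
        unfolding m_def using s t by (intro integral_norm_le_weighted sq_int_diff) auto
      also have "t * sq_norm M (\<lambda>x. s i x - s j x) \<le> t * (e / (4 * t))"
        using N[OF that] t by (intro mult_left_mono) auto
      also have "\<dots> = e / 4" using t by simp
      also have "m / (4 * t) \<le> e / 4"
        using m \<open>e > 0\<close> by (simp add: t_def field_simps)
      finally show ?thesis using \<open>e > 0\<close> by simp
    qed
    then show ?thesis by blast
  qed
  then obtain r where r: "strict_mono r" and ae: "AE x in M. Cauchy (\<lambda>i. s (r i) x)"
    using cauchy_L1_AE_cauchy_subseq[of M s] s sq_int_imp_integrable by blast
  define f where "f = (\<lambda>x. lim (\<lambda>i. s (r i) x))"
  have f_meas [measurable]: "f \<in> borel_measurable M"
    unfolding f_def by (intro borel_measurable_lim_metric) simp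
  have lim: "AE x in M. (\<lambda>i. s (r i) x) \<longlonglongrightarrow> f x"
    using ae unfolding f_def by eventually_elim (simp add: Cauchy_convergent_iff convergent_LIMSEQ_iff)
  \<comment> \<open>Fatou in i along the subsequence with n fixed: the Cauchy bound for s n against
    \<open>s (r i)\<close> survives as a bound against f.\<close>
  have fatou: "(\<integral>\<^sup>+x. ennreal ((norm (s n x - f x))\<^sup>2) \<partial>M) \<le> ennreal e"
    if N: "\<And>i j. i \<ge> N \<Longrightarrow> j \<ge> N \<Longrightarrow> sq_norm M (\<lambda>x. s i x - s j x) < e" and "n \<ge> N" for n N e
  proof -
    have "(\<integral>\<^sup>+x. ennreal ((norm (s n x - f x))\<^sup>2) \<partial>M)
        = (\<integral>\<^sup>+x. liminf (\<lambda>i. ennreal ((norm (s n x - s (r i) x))\<^sup>2)) \<partial>M)"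
    proof (rule nn_integral_cong_AE)
      show "AE x in M. ennreal ((norm (s n x - f x))\<^sup>2)
          = liminf (\<lambda>i. ennreal ((norm (s n x - s (r i) x))\<^sup>2))"
        using lim
      proof eventually_elim
        case (elim x)
        have "(\<lambda>i. ennreal ((norm (s n x - s (r i) x))\<^sup>2)) \<longlonglongrightarrow> ennreal ((norm (s n x - f x))\<^sup>2)"
          by (intro tendsto_intros elim)
        then show ?case by (intro lim_imp_Liminf[symmetric]) auto
      qed
    qed
    also have "\<dots> \<le> liminf (\<lambda>i. \<integral>\<^sup>+x. ennreal ((norm (s n x - s (r i) x))\<^sup>2) \<partial>M)"
      by (rule nn_integral_liminf) simp
    also have "\<dots> \<le> ennreal e"
    proof (rule Liminf_le)
      show "\<forall>\<^sub>F i in sequentially. (\<integral>\<^sup>+x. ennreal ((norm (s n x - s (r i) x))\<^sup>2) \<partial>M) \<le> ennreal e"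
        using eventually_ge_at_top[of N]
      proof eventually_elim
        case (elim i)
        then have "r i \<ge> N" using seq_suble[OF r, of i] by linarith
        then have "sq_norm M (\<lambda>x. s n x - s (r i) x) \<le> e" using N \<open>n \<ge> N\<close> by (meson less_imp_le)
        then show ?case
          using sq_int_diff[OF s[of n] s[of "r i"]]
          by (subst nn_integral_eq_integral) (auto simp: sq_int_def intro: ennreal_leI)
      qed
    qed simp
    finally show ?thesis .
  qed
  have diff: "sq_int M (\<lambda>x. s n x - f x) \<and> sq_norm M (\<lambda>x. s n x - f x) \<le> e"
    if N: "\<And>i j. i \<ge> N \<Longrightarrow> j \<ge> N \<Longrightarrow> sq_norm M (\<lambda>x. s i x - s j x) < e" and "n \<ge> N" "e > 0" for n N e
  proof -
    have *: "(\<integral>\<^sup>+x. ennreal ((norm (s n x - f x))\<^sup>2) \<partial>M) \<le> ennreal e"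
      using fatou[OF N \<open>n \<ge> N\<close>] .
    then have "(\<integral>\<^sup>+x. ennreal (norm ((norm (s n x - f x))\<^sup>2)) \<partial>M) < \<infinity>"
      by (simp add: order.strict_trans1)
    then have i: "integrable M (\<lambda>x. (norm (s n x - f x))\<^sup>2)"
      by (intro integrableI_bounded) auto
    moreover have "sq_norm M (\<lambda>x. s n x - f x) \<le> e"
      using * \<open>e > 0\<close> nn_integral_eq_integral[OF i] by simp
    ultimately show ?thesis by (auto simp: sq_int_def)
  qed
  obtain N where "\<And>i j. i \<ge> N \<Longrightarrow> j \<ge> N \<Longrightarrow> sq_norm M (\<lambda>x. s i x - s j x) < 1"
    using cauchy[of 1] by auto
  then have "sq_int M (\<lambda>x. s N x - f x)" using diff[of N 1 N] by auto
  from sq_int_diff[OF s[of N] this] have "sq_int M f" by simp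
  moreover have "(\<lambda>n. sq_norm M (\<lambda>x. s n x - f x)) \<longlonglongrightarrow> 0"
  proof (rule LIMSEQ_I)
    fix e :: real assume "e > 0"
    then obtain N where "\<And>i j. i \<ge> N \<Longrightarrow> j \<ge> N \<Longrightarrow> sq_norm M (\<lambda>x. s i x - s j x) < e / 2"
      using cauchy[of "e / 2"] by auto
    then have "sq_norm M (\<lambda>x. s n x - f x) \<le> e / 2" if "n \<ge> N" for n
      using diff[of N "e / 2" n] that \<open>e > 0\<close> by auto
    then show "\<exists>N. \<forall>n\<ge>N. norm (sq_norm M (\<lambda>x. s n x - f x) - 0) < e"
      using \<open>e > 0\<close> by (intro exI[of _ N]) (auto, smt (verit) field_sum_of_halves)
  qed
  ultimately show ?thesis by (rule that)
qed

end

section \<open>Gradients and test functions\<close>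

lemma grad_inner_Basis: "i \<in> Basis \<Longrightarrow> grad f x \<bullet> i = frechet_derivative f (at x) i"
  by (simp add: grad_def inner_sum_left_Basis)

lemma has_derivative_grad:
  assumes "f differentiable (at x)"
  shows "(f has_derivative (\<lambda>v. grad f x \<bullet> v)) (at x)"
proof -
  have lin: "linear (frechet_derivative f (at x))"
    using assms by (rule linear_frechet_derivative)
  have "grad f x \<bullet> v = frechet_derivative f (at x) v" for v
  proof -
    have "frechet_derivative f (at x) v = frechet_derivative f (at x) (\<Sum>i\<in>Basis. (v \<bullet> i) *\<^sub>R i)"
      by (simp add: euclidean_representation)
    also have "\<dots> = (\<Sum>i\<in>Basis. (v \<bullet> i) * frechet_derivative f (at x) i)"
      by (simp add: linear_sum[OF lin] linear_cmul[OF lin])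
    also have "\<dots> = grad f x \<bullet> v"
      unfolding grad_def inner_sum_left
      by (intro sum.cong refl) (simp add: inner_commute mult.commute)
    finally show ?thesis by simp
  qed
  then show ?thesis using assms by (simp add: frechet_derivative_works)
qed

lemma gradI:
  assumes "(f has_derivative (\<lambda>v. g \<bullet> v)) (at x)"
  shows "grad f x = g"
  by (rule euclidean_eqI) (simp add: grad_inner_Basis frechet_derivativeI[OF assms])

lemma has_derivative_grad_smooth:
  "smooth_fun f \<Longrightarrow> (f has_derivative (\<lambda>v. grad f x \<bullet> v)) (at x)"
  by (simp add: has_derivative_grad smooth_fun_differentiable)

lemma grad_const: "grad (\<lambda>x. c) x = 0"
  by (rule gradI) simp

lemma grad_add:
  assumes "smooth_fun f" "smooth_fun g"
  shows "grad (\<lambda>x. f x + g x) x = grad f x + grad g x"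
  using assms by (auto intro!: gradI derivative_eq_intros has_derivative_grad_smooth
      simp: inner_add_left)

lemma grad_diff:
  assumes "smooth_fun f" "smooth_fun g"
  shows "grad (\<lambda>x. f x - g x) x = grad f x - grad g x"
  using assms by (auto intro!: gradI derivative_eq_intros has_derivative_grad_smooth
      simp: inner_diff_left)

lemma grad_mult:
  assumes "smooth_fun f" "smooth_fun g"
  shows "grad (\<lambda>x. f x * g x) x = f x *\<^sub>R grad g x + g x *\<^sub>R grad f x"
  using assms by (auto intro!: gradI derivative_eq_intros has_derivative_grad_smooth
      simp: inner_add_left)

lemma grad_cmult: "smooth_fun f \<Longrightarrow> grad (\<lambda>x. c * f x) x = c *\<^sub>R grad f x"
  by (simp add: grad_mult smooth_fun_const grad_const)

lemma grad_inner: "grad (\<lambda>x. a \<bullet> x) x = a"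
  by (auto intro!: gradI derivative_eq_intros)

lemma grad_smooth_pos:
  assumes "\<epsilon> > 0" "smooth_fun f"
  shows "grad (\<lambda>x. smooth_pos \<epsilon> (f x)) x = smooth_pos' \<epsilon> (f x) *\<^sub>R grad f x"
proof (rule gradI)
  show "((\<lambda>x. smooth_pos \<epsilon> (f x)) has_derivative (\<lambda>v. (smooth_pos' \<epsilon> (f x) *\<^sub>R grad f x) \<bullet> v)) (at x)"
    using has_derivative_compose[OF has_derivative_grad_smooth[OF assms(2)]
        has_real_derivative_smooth_pos[OF assms(1), unfolded has_field_derivative_def]]
    by (simp add: mult.commute)
qed

lemma grad_cong_open:
  assumes "open S" "x \<in> S" "\<And>y. y \<in> S \<Longrightarrow> f y = g y" "smooth_fun f"
  shows "grad g x = grad f x"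
proof (rule gradI)
  show "(g has_derivative (\<lambda>v. grad f x \<bullet> v)) (at x)"
    using has_derivative_grad_smooth[OF assms(4)] assms(1-3)
    by (rule has_derivative_transform_within_open)
qed

lemma continuous_on_grad:
  assumes "smooth_fun f"
  shows "continuous_on S (grad f)"
proof -
  have "continuous_on S (\<lambda>x. \<Sum>i\<in>Basis. frechet_derivative f (at x) i *\<^sub>R i)"
    using assms by (intro continuous_intros smooth_fun_continuous_on smooth_fun_partial)
  then show ?thesis by (simp add: grad_def[abs_def])
qed

lemma grad_eq_0_outside:
  assumes "closed S" "\<And>x. x \<notin> S \<Longrightarrow> f x = 0" "x \<notin> S"
  shows "grad f x = 0"
proof -
  have "grad f x = grad (\<lambda>x. 0) x"
    using assms by (intro grad_cong_open[of "- S"]) (auto simp: smooth_fun_const)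
  then show ?thesis by (simp add: grad_const)
qed

section \<open>Closure properties of test functions\<close>

lemma test_funI:
  assumes "smooth_fun \<phi>" "compact S" "S \<subseteq> \<Omega>" "\<And>x. x \<notin> S \<Longrightarrow> \<phi> x = 0"
  shows "test_fun \<Omega> \<phi>"
proof -
  have "closure {x. \<phi> x \<noteq> 0} \<subseteq> S"
    using assms by (intro closure_minimal compact_imp_closed) auto
  moreover from this have "compact (closure {x. \<phi> x \<noteq> 0})"
    using compact_Int_closed[OF assms(2), of "closure {x. \<phi> x \<noteq> 0}"]
    by (simp add: Int_absorb1)
  ultimately show ?thesis using assms by (auto simp: test_fun_def)
qed

lemma test_funE:
  assumes "test_fun \<Omega> \<phi>"
  obtains S where "compact S" "S \<subseteq> \<Omega>" "\<And>x. x \<notin> S \<Longrightarrow> \<phi> x = 0"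
    "\<And>x. x \<notin> S \<Longrightarrow> grad \<phi> x = 0"
proof -
  define S where "S = closure {x. \<phi> x \<noteq> 0}"
  have S: "compact S" "S \<subseteq> \<Omega>" using assms by (auto simp: test_fun_def S_def)
  have z: "\<phi> x = 0" if "x \<notin> S" for x
    using that closure_subset[of "{x. \<phi> x \<noteq> 0}"] by (auto simp: S_def)
  show ?thesis
    using S z grad_eq_0_outside[OF compact_imp_closed[OF S(1)] z] by (rule that)
qed

lemma test_fun_smooth: "test_fun \<Omega> \<phi> \<Longrightarrow> smooth_fun \<phi>"
  by (simp add: test_fun_def)

lemma test_fun_mult_smooth:
  assumes "test_fun \<Omega> \<phi>" "smooth_fun f"
  shows "test_fun \<Omega> (\<lambda>x. \<phi> x * f x)"
proof -
  obtain S where "compact S" "S \<subseteq> \<Omega>" "\<And>x. x \<notin> S \<Longrightarrow> \<phi> x = 0"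
    using assms(1) by (metis test_funE)
  then show ?thesis
    using assms by (intro test_funI[of _ S] smooth_fun_mult) (auto simp: test_fun_smooth)
qed

lemma test_fun_cmult: "test_fun \<Omega> \<phi> \<Longrightarrow> test_fun \<Omega> (\<lambda>x. c * \<phi> x)"
  using test_fun_mult_smooth[OF _ smooth_fun_const[of c]] by (simp add: mult.commute)

lemma test_fun_add:
  assumes "test_fun \<Omega> \<phi>" "test_fun \<Omega> \<psi>"
  shows "test_fun \<Omega> (\<lambda>x. \<phi> x + \<psi> x)"
proof -
  obtain S T where "compact S" "S \<subseteq> \<Omega>" "\<And>x. x \<notin> S \<Longrightarrow> \<phi> x = 0"
    "compact T" "T \<subseteq> \<Omega>" "\<And>x. x \<notin> T \<Longrightarrow> \<psi> x = 0"
    using assms by (metis test_funE)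
  then show ?thesis
    using assms by (intro test_funI[of _ "S \<union> T"] smooth_fun_add) (auto simp: test_fun_smooth)
qed

lemma test_fun_diff:
  "test_fun \<Omega> \<phi> \<Longrightarrow> test_fun \<Omega> \<psi> \<Longrightarrow> test_fun \<Omega> (\<lambda>x. \<phi> x - \<psi> x)"
  using test_fun_add[OF _ test_fun_cmult[of \<Omega> \<psi> "-1"]] by simp

lemma test_fun_0: "test_fun \<Omega> (\<lambda>x. 0)"
  by (rule test_funI[of _ "{}"]) (auto simp: smooth_fun_const)

lemma test_fun_smooth_pos:
  assumes "test_fun \<Omega> \<phi>" "\<epsilon> > 0"
  shows "test_fun \<Omega> (\<lambda>x. smooth_pos \<epsilon> (\<phi> x))"
proof -
  obtain S where "compact S" "S \<subseteq> \<Omega>" "\<And>x. x \<notin> S \<Longrightarrow> \<phi> x = 0"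
    using assms(1) by (metis test_funE)
  then show ?thesis
    using assms
    by (intro test_funI[of _ S] smooth_fun_smooth_pos) (auto simp: test_fun_smooth smooth_pos_eq_0)
qed

section \<open>Integration by parts and the Poincare inequality\<close>

lemma bounded_range_compact_support:
  fixes f :: "'a::euclidean_space \<Rightarrow> 'b::real_normed_vector"
  assumes "continuous_on UNIV f" "compact S" "\<And>x. x \<notin> S \<Longrightarrow> f x = 0"
  obtains B where "B > 0" "\<And>x. norm (f x) \<le> B"
proof -
  have "bounded (f ` S)"
    using assms by (intro compact_imp_bounded compact_continuous_image) (auto intro: continuous_on_subset)
  then obtain B where "B > 0" "\<And>x. x \<in> S \<Longrightarrow> norm (f x) \<le> B"
    by (auto simp: bounded_pos)
  note B = this
  have "norm (f x) \<le> B" for x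
    using B assms(3) by (cases "x \<in> S") auto
  with B(1) show ?thesis by (rule that)
qed

lemma integrable_lborel_compact_support:
  fixes f :: "'a::euclidean_space \<Rightarrow> real"
  assumes "continuous_on UNIV f" "compact S" "\<And>x. x \<notin> S \<Longrightarrow> f x = 0"
  shows "integrable lborel f"
proof -
  have "integrable lborel (\<lambda>x. indicator S x *\<^sub>R f x)"
    using assms by (intro borel_integrable_compact) (auto intro: continuous_on_subset)
  moreover have "(\<lambda>x. indicator S x *\<^sub>R f x) = f"
    using assms(3) by (auto simp: indicator_def fun_eq_iff)
  ultimately show ?thesis by simp
qed

text \<open>Translation invariance makes every difference quotient integrate to zero.\<close>

lemma integral_directional_derivative_eq_0:
  assumes \<phi>: "test_fun \<Omega> \<phi>"
  shows "(LINT x|lborel. grad \<phi> x \<bullet> a) = 0"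
proof -
  obtain S where S: "compact S" "S \<subseteq> \<Omega>" and z: "\<And>x. x \<notin> S \<Longrightarrow> \<phi> x = 0"
    and gz: "\<And>x. x \<notin> S \<Longrightarrow> grad \<phi> x = 0"
    using assms(1) by (metis test_funE)
  have sm: "smooth_fun \<phi>" using \<phi> by (rule test_fun_smooth)
  have cont: "continuous_on UNIV \<phi>" using sm by (rule smooth_fun_continuous_on)
  have contD: "continuous_on UNIV (\<lambda>x. grad \<phi> x \<bullet> a)"
    by (intro continuous_intros continuous_on_grad sm)
  obtain B where B: "B > 0" "\<And>x. norm (grad \<phi> x \<bullet> a) \<le> B"
    using bounded_range_compact_support[OF contD S(1)] gz by (metis inner_zero_left)
  obtain R where R: "\<And>x. x \<in> S \<Longrightarrow> norm x \<le> R"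
    using compact_imp_bounded[OF S(1)] by (auto simp: bounded_iff)
  define t where "t n = inverse (real (Suc n))" for n
  have t: "0 < t n" "t n \<le> 1" for n by (auto simp: t_def field_simps)
  have t0: "t \<longlonglongrightarrow> 0" unfolding t_def by (rule LIMSEQ_inverse_real_of_nat)
  define q where "q n x = (\<phi> (t n *\<^sub>R a + x) - \<phi> x) / t n" for n x
  have line: "((\<lambda>s. \<phi> (s *\<^sub>R a + x)) has_real_derivative grad \<phi> (s *\<^sub>R a + x) \<bullet> a) (at s)" for x s
  proof -
    have "((\<lambda>s. s *\<^sub>R a + x) has_derivative (\<lambda>h. h *\<^sub>R a)) (at s)"
      by (auto intro!: derivative_eq_intros)
    from has_derivative_compose[OF this has_derivative_grad_smooth[OF sm]]
    show ?thesis by (simp add: has_field_derivative_def mult.commute[of _ "_ \<bullet> _"])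
  qed
  have int: "integrable lborel \<phi>"
    using cont S(1) z by (rule integrable_lborel_compact_support)
  have m: "\<phi> \<in> borel_measurable borel" using cont by (rule borel_measurable_continuous_onI)
  have shift: "integrable lborel (\<lambda>x. \<phi> (c + x))" "(LINT x|lborel. \<phi> (c + x)) = (LINT x|lborel. \<phi> x)" for c
    using integrable_distr_eq[of "(+) c" lborel borel \<phi>] integral_distr[of "(+) c" lborel borel \<phi>] int m
    by (simp_all add: lborel_distr_plus)
  have q0: "(LINT x|lborel. q n x) = 0" for n
    unfolding q_def using shift int by simp
  have "(\<lambda>n. LINT x|lborel. q n x) \<longlonglongrightarrow> (LINT x|lborel. grad \<phi> x \<bullet> a)"
  proof (rule integral_dominated_convergence)
    \<comment> \<open>By the mean value theorem each quotient is a value of the directional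
      derivative, hence at most B in norm. It vanishes outside this ball because shifts by
      \<open>t n *\<^sub>R a\<close> have length at most \<open>norm a\<close>.\<close>
    show "integrable lborel (\<lambda>x. indicator (cball 0 (R + norm a)) x *\<^sub>R B)"
      by (intro borel_integrable_compact) auto
    show "(\<lambda>x. grad \<phi> x \<bullet> a) \<in> borel_measurable lborel"
      using borel_measurable_continuous_onI[OF contD] by simp
    show "q n \<in> borel_measurable lborel" for n
      unfolding q_def using m by simp
    show "AE x in lborel. (\<lambda>n. q n x) \<longlonglongrightarrow> grad \<phi> x \<bullet> a"
    proof (intro AE_I2)
      fix x
      have "((\<lambda>h. (\<phi> (h *\<^sub>R a + x) - \<phi> x) / h) \<longlongrightarrow> grad \<phi> x \<bullet> a) (at 0)"
        using line[of x 0] by (simp add: DERIV_def)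
      moreover have "filterlim t (at 0) sequentially"
        using t0 t by (auto simp: filterlim_at less_imp_neq[THEN not_sym])
      ultimately show "(\<lambda>n. q n x) \<longlonglongrightarrow> grad \<phi> x \<bullet> a"
        unfolding q_def by (rule filterlim_compose)
    qed
    show "AE x in lborel. norm (q n x) \<le> indicator (cball 0 (R + norm a)) x *\<^sub>R B" for n
    proof (intro AE_I2)
      fix x
      show "norm (q n x) \<le> indicator (cball 0 (R + norm a)) x *\<^sub>R B"
      proof (cases "norm x \<le> R + norm a")
        case True
        obtain \<xi> where "\<phi> (t n *\<^sub>R a + x) - \<phi> (0 *\<^sub>R a + x) = (t n - 0) * (grad \<phi> (\<xi> *\<^sub>R a + x) \<bullet> a)"
          using MVT2[of 0 "t n" "\<lambda>s. \<phi> (s *\<^sub>R a + x)" "\<lambda>s. grad \<phi> (s *\<^sub>R a + x) \<bullet> a"] t line by metis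
        then have "q n x = grad \<phi> (\<xi> *\<^sub>R a + x) \<bullet> a"
          using t[of n] by (simp add: q_def)
        then show ?thesis using B True by (auto simp: indicator_def)
      next
        case False
        have "norm x \<le> norm (t n *\<^sub>R a + x) + norm (t n *\<^sub>R a)"
          using norm_triangle_ineq4[of "t n *\<^sub>R a + x" "t n *\<^sub>R a"] by simp
        moreover have "norm (t n *\<^sub>R a) \<le> norm a"
          using t[of n] by (simp add: mult_left_le_one_le)
        ultimately have "t n *\<^sub>R a + x \<notin> S" using R False by fastforce
        moreover have "x \<notin> S" using R False norm_ge_zero[of a] by fastforce
        ultimately show ?thesis using z B by (simp add: q_def indicator_def)
      qed
    qed
  qed
  then show ?thesis using q0 by (simp add: LIMSEQ_const_iff)
qed

locale bounded_open_set =
  fixes \<Omega> :: "'a::euclidean_space set"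
  assumes open_\<Omega>: "open \<Omega>" and bounded_\<Omega>: "bounded \<Omega>"
begin

abbreviation "M \<equiv> lebesgue_on \<Omega>"

lemma \<Omega>_sets [measurable]: "\<Omega> \<in> sets lebesgue"
  using open_\<Omega> by auto

sublocale fin: finite_measure M
proof (rule finite_measureI)
  have "emeasure lebesgue \<Omega> < \<infinity>"
    using bounded_set_imp_lmeasurable[OF bounded_\<Omega> \<Omega>_sets] by (simp add: fmeasurable_def)
  then show "emeasure M (space M) \<noteq> \<infinity>"
    by (simp add: emeasure_restrict_space space_restrict_space)
qed

lemma AE_M_iff: "(AE x in M. P x) \<longleftrightarrow> (AE x in lebesgue. x \<in> \<Omega> \<longrightarrow> P x)"
  by (rule AE_restrict_space_iff) simp

lemma set_integrable_iff_M:
  fixes f :: "'a \<Rightarrow> 'b::{banach, second_countable_topology}"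
  shows "set_integrable lebesgue \<Omega> f \<longleftrightarrow> integrable M f"
  by (simp add: set_integrable_def integrable_restrict_space)

lemma set_integral_eq_M:
  fixes f :: "'a \<Rightarrow> 'b::{banach, second_countable_topology}"
  shows "(LINT x:\<Omega>|lebesgue. f x) = (LINT x|M. f x)"
  by (simp add: set_lebesgue_integral_def integral_restrict_space)

lemma L2_on_iff_sq_int: "L2_on \<Omega> f \<longleftrightarrow> sq_int M f"
  by (simp add: L2_on_def sq_int_def set_integrable_iff_M)

lemma continuous_imp_measurable_M:
  assumes "continuous_on UNIV f"
  shows "f \<in> borel_measurable M"
proof -
  have "f \<in> borel_measurable lebesgue"
    using borel_measurable_continuous_onI[OF assms] by (intro measurable_completion) simp
  then show ?thesis by (rule measurable_restrict_space1)
qed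

lemma sq_int_continuous:
  assumes "continuous_on UNIV f"
  shows "sq_int M f"
proof -
  have "compact (closure \<Omega>)" using bounded_\<Omega> by (simp add: compact_closure)
  then have "bounded (f ` closure \<Omega>)"
    using assms by (intro compact_imp_bounded compact_continuous_image) (auto intro: continuous_on_subset)
  then obtain B where "\<And>x. x \<in> closure \<Omega> \<Longrightarrow> norm (f x) \<le> B"
    by (auto simp: bounded_iff)
  then have "AE x in M. norm (f x) \<le> B"
    using closure_subset by (intro AE_I2) (auto simp: space_restrict_space)
  with continuous_imp_measurable_M[OF assms] show ?thesis
    by (rule fin.sq_int_bounded)
qed

lemma sq_int_smooth: "smooth_fun f \<Longrightarrow> sq_int M f"
  by (simp add: sq_int_continuous smooth_fun_continuous_on)

lemma sq_int_grad: "smooth_fun f \<Longrightarrow> sq_int M (grad f)"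
  by (simp add: sq_int_continuous continuous_on_grad)

lemma integral_grad_test_eq_0:
  assumes "test_fun \<Omega> \<phi>"
  shows "(LINT x|M. grad \<phi> x \<bullet> a) = 0"
proof -
  obtain S where S: "S \<subseteq> \<Omega>" "\<And>x. x \<notin> S \<Longrightarrow> grad \<phi> x = 0"
    using assms by (metis test_funE)
  then have z: "grad \<phi> x = 0" if "x \<notin> \<Omega>" for x
    using that by blast
  have "(LINT x|M. grad \<phi> x \<bullet> a) = (LINT x|lebesgue. indicator \<Omega> x *\<^sub>R (grad \<phi> x \<bullet> a))"
    by (simp add: integral_restrict_space)
  also have "(\<lambda>x. indicator \<Omega> x *\<^sub>R (grad \<phi> x \<bullet> a)) = (\<lambda>x. grad \<phi> x \<bullet> a)"
    using z by (force simp: indicator_def)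
  also have "(LINT x|lebesgue. grad \<phi> x \<bullet> a) = (LINT x|lborel. grad \<phi> x \<bullet> a)"
  proof (rule integral_completion)
    have "continuous_on UNIV (\<lambda>x. grad \<phi> x \<bullet> a)"
      using assms by (intro continuous_intros continuous_on_grad test_fun_smooth)
    then show "(\<lambda>x. grad \<phi> x \<bullet> a) \<in> borel_measurable lborel"
      using borel_measurable_continuous_onI by simp
  qed
  finally show ?thesis using integral_directional_derivative_eq_0[OF assms] by simp
qed

text \<open>The product of a test function and a smooth function is a test function, so its
  derivative has integral zero. Only \<phi> carries the compact support; f can be a polynomial such
  as a linear coordinate or the slope of the slab barrier.\<close>

lemma integration_by_parts:
  assumes "test_fun \<Omega> \<phi>" "smooth_fun f"
  shows "(LINT x|M. f x * (grad \<phi> x \<bullet> a)) = - (LINT x|M. \<phi> x * (grad f x \<bullet> a))"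
proof -
  have sm: "smooth_fun \<phi>" using assms(1) by (rule test_fun_smooth)
  have sq: "sq_int M (\<lambda>x. grad \<psi> x \<bullet> a)" if "smooth_fun \<psi>" for \<psi>
    using that by (intro sq_int_continuous continuous_intros continuous_on_grad)
  have i: "integrable M (\<lambda>x. f x * (grad \<phi> x \<bullet> a))" "integrable M (\<lambda>x. \<phi> x * (grad f x \<bullet> a))"
    using integrable_inner_sq_int[OF sq_int_smooth[OF assms(2)] sq[OF sm]]
      integrable_inner_sq_int[OF sq_int_smooth[OF sm] sq[OF assms(2)]] by simp_all
  have "0 = (LINT x|M. grad (\<lambda>x. \<phi> x * f x) x \<bullet> a)"
    using integral_grad_test_eq_0[OF test_fun_mult_smooth[OF assms]] by simp
  also have "\<dots> = (LINT x|M. \<phi> x * (grad f x \<bullet> a) + f x * (grad \<phi> x \<bullet> a))"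
    using sm assms(2) by (simp add: grad_mult inner_add_left)
  also have "\<dots> = (LINT x|M. \<phi> x * (grad f x \<bullet> a)) + (LINT x|M. f x * (grad \<phi> x \<bullet> a))"
    using i by simp
  finally show ?thesis by linarith
qed

text \<open>Integrate \<open>\<phi>\<^sup>2\<close> by parts against the field \<open>(a \<bullet> x) a\<close>,
  whose divergence is 1.\<close>

lemma poincare:
  obtains C where "C > 0" "\<And>\<phi>. test_fun \<Omega> \<phi> \<Longrightarrow> sq_norm M \<phi> \<le> C * sq_norm M (grad \<phi>)"
proof -
  obtain R where R: "R > 0" "\<And>x. x \<in> \<Omega> \<Longrightarrow> norm x \<le> R"
    using bounded_\<Omega> by (auto simp: bounded_pos)
  define a :: 'a where "a = (SOME i. i \<in> Basis)"
  have a: "norm a = 1" by (simp add: a_def some_in_eq)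
  have "sq_norm M \<phi> \<le> (4 * R\<^sup>2) * sq_norm M (grad \<phi>)" if \<phi>: "test_fun \<Omega> \<phi>" for \<phi>
  proof -
    have sm: "smooth_fun \<phi>" using \<phi> by (rule test_fun_smooth)
    define h where "h x = (a \<bullet> x) * (grad \<phi> x \<bullet> a)" for x
    have h: "sq_int M h"
      unfolding h_def using sm by (intro sq_int_continuous continuous_intros continuous_on_grad)
    have sq: "sq_int M \<phi>" using sm by (rule sq_int_smooth)
    have "(LINT x|M. (a \<bullet> x) * (grad (\<lambda>x. \<phi> x * \<phi> x) x \<bullet> a))
        = - (LINT x|M. (\<phi> x * \<phi> x) * (grad ((\<bullet>) a) x \<bullet> a))"
      by (intro integration_by_parts test_fun_mult_smooth smooth_fun_inner \<phi> sm)
    moreover have "grad ((\<bullet>) a) x \<bullet> a = 1" for x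
      using a by (simp add: grad_inner norm_eq_1)
    moreover have "(a \<bullet> x) * (grad (\<lambda>x. \<phi> x * \<phi> x) x \<bullet> a) = 2 * (\<phi> x \<bullet> h x)" for x
      using sm by (simp add: grad_mult h_def algebra_simps inner_add_left)
    ultimately have "2 * (LINT x|M. \<phi> x \<bullet> h x) = - sq_norm M \<phi>"
      by (simp add: power2_eq_square)
    \<comment> \<open>Doubling this bound puts half of \<open>sq_norm M \<phi>\<close> on the right,
      where it is absorbed, and leaves \<open>sq_norm M \<phi> \<le> 4 * sq_norm M h\<close>. This
      is the 4 in the constant \<open>4 * R\<^sup>2\<close>.\<close>
    moreover have "\<bar>LINT x|M. \<phi> x \<bullet> h x\<bar> \<le> (1/4) * sq_norm M \<phi> + sq_norm M h / (4 * (1/4))"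
      using sq h by (rule integral_inner_le_weighted) simp
    moreover have "sq_norm M h \<le> (LINT x|M. R\<^sup>2 * (norm (grad \<phi> x))\<^sup>2)"
    proof (rule integral_mono)
      show "integrable M (\<lambda>x. R\<^sup>2 * (norm (grad \<phi> x))\<^sup>2)"
        using sq_int_grad[OF sm] by (auto simp: sq_int_def)
      fix x assume "x \<in> space M"
      then have "norm x \<le> R" using R by (auto simp: space_restrict_space)
      then have "\<bar>a \<bullet> x\<bar> \<le> R" using Cauchy_Schwarz_ineq2[of a x] a by simp
      moreover have "\<bar>grad \<phi> x \<bullet> a\<bar> \<le> norm (grad \<phi> x)"
        using Cauchy_Schwarz_ineq2[of "grad \<phi> x" a] a by simp
      ultimately have "\<bar>h x\<bar> \<le> R * norm (grad \<phi> x)"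
        unfolding h_def abs_mult using R by (intro mult_mono) auto
      then have "\<bar>h x\<bar>\<^sup>2 \<le> (R * norm (grad \<phi> x))\<^sup>2" by (intro power_mono) auto
      then show "(norm (h x))\<^sup>2 \<le> R\<^sup>2 * (norm (grad \<phi> x))\<^sup>2" by (simp add: power_mult_distrib)
    qed (use h in \<open>auto simp: sq_int_def\<close>)
    ultimately show ?thesis using sq_int_grad[OF sm] by (simp add: sq_int_def)
  qed
  then show ?thesis using R by (intro that[of "4 * R\<^sup>2"]) auto
qed

end

section \<open>The linear Dirichlet problem\<close>

lemma sq_norm_lincomb:
  assumes "sq_int M f" "sq_int M g"
  shows "sq_norm M (\<lambda>x. a *\<^sub>R f x + b *\<^sub>R g x)
    = a\<^sup>2 * sq_norm M f + 2 * a * b * (LINT x|M. f x \<bullet> g x) + b\<^sup>2 * sq_norm M g"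
proof -
  have "(norm (a *\<^sub>R f x + b *\<^sub>R g x))\<^sup>2
      = a\<^sup>2 * (norm (f x))\<^sup>2 + 2 * a * b * (f x \<bullet> g x) + b\<^sup>2 * (norm (g x))\<^sup>2" for x
    unfolding power2_norm_eq_inner
    by (simp add: inner_add_left inner_add_right inner_commute power2_eq_square algebra_simps)
  then show ?thesis
    using assms integrable_inner_sq_int[OF assms] by (simp add: sq_int_def)
qed

lemma tendsto_sq_norm_diff:
  assumes "\<And>k. sq_int M (f k)" "\<And>k. sq_int M (g k)" "sq_int M f'" "sq_int M g'"
    and f: "(\<lambda>k. sq_norm M (\<lambda>x. f k x - f' x)) \<longlonglongrightarrow> 0"
    and g: "(\<lambda>k. sq_norm M (\<lambda>x. g k x - g' x)) \<longlonglongrightarrow> 0"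
  shows "(\<lambda>k. sq_norm M (\<lambda>x. (f k x - g k x) - (f' x - g' x))) \<longlonglongrightarrow> 0"
proof (rule tendsto_sandwich[OF _ _ tendsto_const])
  show "(\<lambda>k. 2 * sq_norm M (\<lambda>x. f k x - f' x) + 2 * sq_norm M (\<lambda>x. g k x - g' x)) \<longlonglongrightarrow> 0"
    using tendsto_add[OF tendsto_mult_left[OF f, of 2] tendsto_mult_left[OF g, of 2]] by simp
  have "(f k x - g k x) - (f' x - g' x) = (f k x - f' x) - (g k x - g' x)" for k x
    by simp
  then show "\<forall>\<^sub>F k in sequentially. sq_norm M (\<lambda>x. (f k x - g k x) - (f' x - g' x))
      \<le> 2 * sq_norm M (\<lambda>x. f k x - f' x) + 2 * sq_norm M (\<lambda>x. g k x - g' x)"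
    using assms by (simp only:) (intro always_eventually allI sq_norm_diff_le sq_int_diff)
qed (simp add: sq_norm_nonneg)

context bounded_open_set
begin

text \<open>The closure of the graph of \<open>grad\<close> on test functions, in L2 for both
  components. The gradient is carried along as a separate function g.\<close>

definition H10 :: "('a \<Rightarrow> real) \<Rightarrow> ('a \<Rightarrow> 'a) \<Rightarrow> bool" where
  "H10 u g \<longleftrightarrow> sq_int M u \<and> sq_int M g \<and> (\<exists>\<phi>s. (\<forall>k. test_fun \<Omega> (\<phi>s k))
     \<and> (\<lambda>k. sq_norm M (\<lambda>x. \<phi>s k x - u x)) \<longlonglongrightarrow> 0
     \<and> (\<lambda>k. sq_norm M (\<lambda>x. grad (\<phi>s k) x - g x)) \<longlonglongrightarrow> 0)"

definition poisson :: "('a \<Rightarrow> real) \<Rightarrow> ('a \<Rightarrow> real) \<Rightarrow> ('a \<Rightarrow> 'a) \<Rightarrow> bool" where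
  "poisson F u g \<longleftrightarrow> H10 u g \<and>
     (\<forall>\<phi>. test_fun \<Omega> \<phi> \<longrightarrow> (LINT x|M. g x \<bullet> grad \<phi> x) = (LINT x|M. F x * \<phi> x))"

lemma integrable_mult_test:
  assumes "sq_int M F" "smooth_fun \<phi>"
  shows "integrable M (\<lambda>x. F x * \<phi> x)"
  using integrable_inner_sq_int[OF assms(1) sq_int_smooth[OF assms(2)]] by simp

text \<open>Integration by parts holds for each approximating test function and passes to the L2
  limit. It is done coordinate by coordinate, since the convergence lemma concerns scalar
  integrals.\<close>

lemma H10_imp_W120:
  assumes "H10 u g"
  shows "W120 \<Omega> u g"
proof -
  obtain \<phi>s where \<phi>s: "\<And>k. test_fun \<Omega> (\<phi>s k)"
    "(\<lambda>k. sq_norm M (\<lambda>x. \<phi>s k x - u x)) \<longlonglongrightarrow> 0"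
    "(\<lambda>k. sq_norm M (\<lambda>x. grad (\<phi>s k) x - g x)) \<longlonglongrightarrow> 0"
    and u: "sq_int M u" and g: "sq_int M g"
    using assms by (auto simp: H10_def)
  note sm = test_fun_smooth[OF \<phi>s(1)]
  have "weak_grad \<Omega> u g"
    unfolding weak_grad_def set_integrable_iff_M set_integral_eq_M
  proof (intro allI impI)
    fix \<theta> assume \<theta>: "test_fun \<Omega> \<theta>"
    have st: "smooth_fun \<theta>" using \<theta> by (rule test_fun_smooth)
    have scaled: "integrable M (\<lambda>x. a x *\<^sub>R b x)" if "sq_int M a" "sq_int M b" for a :: "'a \<Rightarrow> real" and b :: "'a \<Rightarrow> 'a"
    proof (rule Bochner_Integration.integrable_bound)
      show "integrable M (\<lambda>x. (norm (a x)) \<bullet> (norm (b x)))"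
        using that by (intro integrable_inner_sq_int) (auto simp: sq_int_def)
    qed (use that in \<open>auto simp: sq_int_def\<close>)
    have i1: "integrable M (\<lambda>x. u x *\<^sub>R grad \<theta> x)" and i2: "integrable M (\<lambda>x. \<theta> x *\<^sub>R g x)"
      using u g st by (auto intro!: scaled sq_int_smooth sq_int_grad)
    have "(LINT x|M. u x *\<^sub>R grad \<theta> x) \<bullet> i = (- (LINT x|M. \<theta> x *\<^sub>R g x)) \<bullet> i" if "i \<in> Basis" for i
    proof -
      have s1: "sq_int M (\<lambda>x. grad \<theta> x \<bullet> i)"
        using st by (intro sq_int_continuous continuous_intros continuous_on_grad)
      have s2: "sq_int M (\<lambda>x. \<theta> x *\<^sub>R i)"
        using st by (intro sq_int_continuous continuous_intros smooth_fun_continuous_on)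
      have "(\<lambda>k. LINT x|M. \<phi>s k x \<bullet> (grad \<theta> x \<bullet> i)) \<longlonglongrightarrow> (LINT x|M. u x \<bullet> (grad \<theta> x \<bullet> i))"
        using \<phi>s(2) u s1 sq_int_smooth[OF sm] by (intro tendsto_integral_inner)
      moreover have lim: "(\<lambda>k. LINT x|M. grad (\<phi>s k) x \<bullet> (\<theta> x *\<^sub>R i)) \<longlonglongrightarrow> (LINT x|M. g x \<bullet> (\<theta> x *\<^sub>R i))"
        using \<phi>s(3) g s2 sq_int_grad[OF sm] by (intro tendsto_integral_inner)
      moreover have "(LINT x|M. \<phi>s k x \<bullet> (grad \<theta> x \<bullet> i)) = - (LINT x|M. grad (\<phi>s k) x \<bullet> (\<theta> x *\<^sub>R i))" for k
        using integration_by_parts[OF \<theta> sm, of k i] by simp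
      ultimately have "(LINT x|M. u x \<bullet> (grad \<theta> x \<bullet> i)) = - (LINT x|M. g x \<bullet> (\<theta> x *\<^sub>R i))"
        using LIMSEQ_unique[OF _ tendsto_minus[OF lim]] by simp
      then show ?thesis
        using integral_inner_left[OF i1, of i] integral_inner_left[OF i2, of i] by simp
    qed
    then show "integrable M (\<lambda>x. u x *\<^sub>R grad \<theta> x) \<and> integrable M (\<lambda>x. \<theta> x *\<^sub>R g x) \<and>
        (LINT x|M. u x *\<^sub>R grad \<theta> x) = - (LINT x|M. \<theta> x *\<^sub>R g x)"
      using i1 i2 by (auto intro: euclidean_eqI)
  qed
  then show ?thesis
    using \<phi>s u g by (auto simp: W120_def L2_on_iff_sq_int set_integral_eq_M)
qed

lemma H10_approx:
  assumes "H10 u g"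
  obtains \<phi> where "\<And>k. test_fun \<Omega> (\<phi> k)" "\<And>k. smooth_fun (\<phi> k)"
    "(\<lambda>k. sq_norm M (\<lambda>x. \<phi> k x - u x)) \<longlonglongrightarrow> 0"
    "(\<lambda>k. sq_norm M (\<lambda>x. grad (\<phi> k) x - g x)) \<longlonglongrightarrow> 0"
proof -
  obtain \<phi> where "\<And>k. test_fun \<Omega> (\<phi> k)"
    "(\<lambda>k. sq_norm M (\<lambda>x. \<phi> k x - u x)) \<longlonglongrightarrow> 0"
    "(\<lambda>k. sq_norm M (\<lambda>x. grad (\<phi> k) x - g x)) \<longlonglongrightarrow> 0"
    using assms unfolding H10_def by blast
  then show ?thesis by (intro that[of \<phi>] test_fun_smooth)
qed

text \<open>A minimising sequence of the Dirichlet energy is Cauchy by the parallelogram law;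
  its limit satisfies the Euler--Lagrange equation.\<close>

lemma poisson_exists:
  assumes F: "sq_int M F"
  obtains u g where "poisson F u g"
proof -
  obtain C where C: "C > 0" "\<And>\<phi>. test_fun \<Omega> \<phi> \<Longrightarrow> sq_norm M \<phi> \<le> C * sq_norm M (grad \<phi>)"
    using poincare by blast
  define L where "L \<phi> = (LINT x|M. F x * \<phi> x)" for \<phi>
  define E where "E \<phi> = sq_norm M (grad \<phi>) / 2 - L \<phi>" for \<phi>
  define m where "m = Inf (E ` {\<phi>. test_fun \<Omega> \<phi>})"
  \<comment> \<open>Young's inequality with weight C/2, so that Poincare turns the \<phi> term into
    exactly the quadratic part of the energy.\<close>
  have lower: "- (C / 2 * sq_norm M F) \<le> E \<phi>" if "test_fun \<Omega> \<phi>" for \<phi>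
  proof -
    have "\<bar>LINT x|M. F x \<bullet> \<phi> x\<bar> \<le> C / 2 * sq_norm M F + sq_norm M \<phi> / (4 * (C / 2))"
      using F sq_int_smooth[OF test_fun_smooth[OF that]] C by (intro integral_inner_le_weighted) auto
    moreover have "sq_norm M \<phi> / (4 * (C / 2)) \<le> sq_norm M (grad \<phi>) / 2"
      using C(2)[OF that] C(1) by (simp add: field_simps)
    ultimately show ?thesis by (simp add: E_def L_def)
  qed
  have bdd: "bdd_below (E ` {\<phi>. test_fun \<Omega> \<phi>})"
    using lower by (intro bdd_belowI2[of _ "- (C / 2 * sq_norm M F)"]) simp
  have m_le: "m \<le> E \<phi>" if "test_fun \<Omega> \<phi>" for \<phi>
    unfolding m_def using bdd that by (intro cInf_lower) auto
  have "\<exists>\<phi>. test_fun \<Omega> \<phi> \<and> E \<phi> < m + inverse (real (Suc k))" for k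
    using cInf_lessD[of "E ` {\<phi>. test_fun \<Omega> \<phi>}" "m + inverse (real (Suc k))"] test_fun_0
    unfolding m_def by auto
  then obtain \<phi> where \<phi>: "\<And>k. test_fun \<Omega> (\<phi> k)" "\<And>k. E (\<phi> k) < m + inverse (real (Suc k))"
    by metis
  note sm = test_fun_smooth[OF \<phi>(1)]
  have comb: "test_fun \<Omega> (\<lambda>x. a * f x + b * g x)"
    "sq_norm M (grad (\<lambda>x. a * f x + b * g x)) = a\<^sup>2 * sq_norm M (grad f)
       + 2 * a * b * (LINT x|M. grad f x \<bullet> grad g x) + b\<^sup>2 * sq_norm M (grad g)"
    "L (\<lambda>x. a * f x + b * g x) = a * L f + b * L g"
    if "test_fun \<Omega> f" "test_fun \<Omega> g" for a b f g
  proof -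
    have s: "smooth_fun f" "smooth_fun g" using that by (auto simp: test_fun_smooth)
    show "test_fun \<Omega> (\<lambda>x. a * f x + b * g x)"
      using that by (intro test_fun_add test_fun_cmult)
    have "grad (\<lambda>x. a * f x + b * g x) = (\<lambda>x. a *\<^sub>R grad f x + b *\<^sub>R grad g x)"
      using s by (intro ext) (simp add: grad_add grad_cmult smooth_fun_mult smooth_fun_const)
    then show "sq_norm M (grad (\<lambda>x. a * f x + b * g x)) = a\<^sup>2 * sq_norm M (grad f)
       + 2 * a * b * (LINT x|M. grad f x \<bullet> grad g x) + b\<^sup>2 * sq_norm M (grad g)"
      using sq_norm_lincomb[OF sq_int_grad[OF s(1)] sq_int_grad[OF s(2)], of a b] by simp
    have "F x * (a * f x + b * g x) = a * (F x * f x) + b * (F x * g x)" for x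
      by (simp add: algebra_simps)
    then show "L (\<lambda>x. a * f x + b * g x) = a * L f + b * L g"
      unfolding L_def using integrable_mult_test[OF F s(1)] integrable_mult_test[OF F s(2)] by simp
  qed
  have para: "sq_norm M (\<lambda>x. grad (\<phi> i) x - grad (\<phi> j) x) \<le> 4 * (E (\<phi> i) - m) + 4 * (E (\<phi> j) - m)" for i j
  proof -
    \<comment> \<open>The squared distance of the gradients equals 4 E(\<phi> i) + 4 E(\<phi> j)
      minus 8 times the energy of the midpoint; the linear parts cancel. The midpoint is a
      competitor, so its energy is at least m.\<close>
    have "m \<le> E (\<lambda>x. 1/2 * \<phi> i x + 1/2 * \<phi> j x)" using m_le comb(1) \<phi>(1) by blast
    also have "\<dots> = sq_norm M (grad (\<phi> i)) / 8 + sq_norm M (grad (\<phi> j)) / 8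
        + (LINT x|M. grad (\<phi> i) x \<bullet> grad (\<phi> j) x) / 4 - L (\<phi> i) / 2 - L (\<phi> j) / 2"
      unfolding E_def comb(2)[OF \<phi>(1) \<phi>(1)] comb(3)[OF \<phi>(1) \<phi>(1)]
      by (simp add: field_simps power2_eq_square)
    finally have *: "m \<le> \<dots>" .
    have "sq_norm M (\<lambda>x. grad (\<phi> i) x - grad (\<phi> j) x)
      = sq_norm M (grad (\<phi> i)) - 2 * (LINT x|M. grad (\<phi> i) x \<bullet> grad (\<phi> j) x) + sq_norm M (grad (\<phi> j))"
      using sq_norm_lincomb[OF sq_int_grad[OF sm[of i]] sq_int_grad[OF sm[of j]], of 1 "-1"] by simp
    with * show ?thesis by (simp add: E_def)
  qed
  have small: "\<exists>N. \<forall>k\<ge>N. E (\<phi> k) - m < e" if "e > 0" for e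
  proof -
    obtain N where N: "inverse (real (Suc N)) < e" using reals_Archimedean[OF \<open>e > 0\<close>] by blast
    have "E (\<phi> k) - m < e" if "k \<ge> N" for k
    proof -
      have "inverse (real (Suc k)) \<le> inverse (real (Suc N))"
        using that by (simp add: field_simps)
      then show ?thesis using \<phi>(2)[of k] N by linarith
    qed
    then show ?thesis by blast
  qed
  have cauchy_g: "\<exists>N. \<forall>i\<ge>N. \<forall>j\<ge>N. sq_norm M (\<lambda>x. grad (\<phi> i) x - grad (\<phi> j) x) < e" if "e > 0" for e
  proof -
    obtain N where N: "\<And>k. k \<ge> N \<Longrightarrow> E (\<phi> k) - m < e / 8" using small[of "e / 8"] \<open>e > 0\<close> by auto
    have "sq_norm M (\<lambda>x. grad (\<phi> i) x - grad (\<phi> j) x) < e" if "i \<ge> N" "j \<ge> N" for i j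
    proof -
      have "4 * (E (\<phi> i) - m) + 4 * (E (\<phi> j) - m) < e"
        using N[OF that(1)] N[OF that(2)] by simp
      with para[of i j] show ?thesis by (rule le_less_trans)
    qed
    then show ?thesis by blast
  qed
  have cauchy_u: "\<exists>N. \<forall>i\<ge>N. \<forall>j\<ge>N. sq_norm M (\<lambda>x. \<phi> i x - \<phi> j x) < e" if "e > 0" for e
  proof -
    obtain N where N: "\<forall>i\<ge>N. \<forall>j\<ge>N. sq_norm M (\<lambda>x. grad (\<phi> i) x - grad (\<phi> j) x) < e / C"
      using cauchy_g[of "e / C"] \<open>e > 0\<close> C by auto
    have "sq_norm M (\<lambda>x. \<phi> i x - \<phi> j x) < e" if "i \<ge> N" "j \<ge> N" for i j
    proof -
      have "sq_norm M (\<lambda>x. \<phi> i x - \<phi> j x) \<le> C * sq_norm M (grad (\<lambda>x. \<phi> i x - \<phi> j x))"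
        using C(2)[OF test_fun_diff[OF \<phi>(1) \<phi>(1)]] .
      also have "\<dots> = C * sq_norm M (\<lambda>x. grad (\<phi> i) x - grad (\<phi> j) x)"
        by (simp add: grad_diff sm)
      also have "\<dots> < C * (e / C)" using N that C(1) by (intro mult_strict_left_mono) auto
      finally show ?thesis using C(1) by simp
    qed
    then show ?thesis by blast
  qed
  obtain g where g: "sq_int M g" "(\<lambda>k. sq_norm M (\<lambda>x. grad (\<phi> k) x - g x)) \<longlonglongrightarrow> 0"
    using fin.sq_int_complete[of "\<lambda>k. grad (\<phi> k)"] sq_int_grad[OF sm] cauchy_g by blast
  obtain u where u: "sq_int M u" "(\<lambda>k. sq_norm M (\<lambda>x. \<phi> k x - u x)) \<longlonglongrightarrow> 0"
    using fin.sq_int_complete[of \<phi>] sq_int_smooth[OF sm] cauchy_u by blast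
  have "(LINT x|M. g x \<bullet> grad \<theta> x) = L \<theta>" if \<theta>: "test_fun \<Omega> \<theta>" for \<theta>
  proof -
    define A where "A = (LINT x|M. g x \<bullet> grad \<theta> x) - L \<theta>"
    define B where "B = sq_norm M (grad \<theta>)"
    have lim: "(\<lambda>k. LINT x|M. grad (\<phi> k) x \<bullet> grad \<theta> x) \<longlonglongrightarrow> (LINT x|M. g x \<bullet> grad \<theta> x)"
      using g sq_int_grad[OF sm] sq_int_grad[OF test_fun_smooth[OF \<theta>]]
      by (intro tendsto_integral_inner)
    \<comment> \<open>First variation: \<phi> k + t \<theta> has energy at least m, while \<phi> k
      is within 1/(k+1) of m. In the limit a quadratic polynomial in t stays nonnegative for both
      signs of t.\<close>
    have pos: "0 \<le> t * A + t\<^sup>2 / 2 * B" for t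
    proof (rule LIMSEQ_le_const)
      show "(\<lambda>k. inverse (real (Suc k)) + t * ((LINT x|M. grad (\<phi> k) x \<bullet> grad \<theta> x) - L \<theta>) + t\<^sup>2 / 2 * B)
        \<longlonglongrightarrow> t * A + t\<^sup>2 / 2 * B"
        unfolding A_def
        using tendsto_add[OF tendsto_add[OF LIMSEQ_inverse_real_of_nat
            tendsto_mult_left[OF tendsto_diff[OF lim tendsto_const]]] tendsto_const]
        by simp
      have "0 \<le> inverse (real (Suc k)) + t * ((LINT x|M. grad (\<phi> k) x \<bullet> grad \<theta> x) - L \<theta>) + t\<^sup>2 / 2 * B" for k
      proof -
        have "m \<le> E (\<lambda>x. 1 * \<phi> k x + t * \<theta> x)" using m_le comb(1) \<phi>(1) \<theta> by blast
        also have "\<dots> = E (\<phi> k) + t * ((LINT x|M. grad (\<phi> k) x \<bullet> grad \<theta> x) - L \<theta>) + t\<^sup>2 / 2 * B"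
          unfolding E_def comb(2)[OF \<phi>(1) \<theta>] comb(3)[OF \<phi>(1) \<theta>] B_def
          by (simp add: field_simps)
        finally show ?thesis using \<phi>(2)[of k] by linarith
      qed
      then show "\<exists>N. \<forall>k\<ge>N. 0 \<le> inverse (real (Suc k)) +
          t * ((LINT x|M. grad (\<phi> k) x \<bullet> grad \<theta> x) - L \<theta>) + t\<^sup>2 / 2 * B"
        by blast
    qed
    have B: "B \<ge> 0" by (simp add: B_def)
    have "A = 0"
    proof (rule ccontr)
      assume "A \<noteq> 0"
      \<comment> \<open>The minimiser of the quadratic would be -A/B; adding 1 covers the case B =
        0, and the value at -s is still strictly negative.\<close>
      define s where "s = A / (B + 1)"
      have s: "A = s * (B + 1)" "s \<noteq> 0" using B \<open>A \<noteq> 0\<close> by (auto simp: s_def)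
      have "(- s) * A + (- s)\<^sup>2 / 2 * B = - (s\<^sup>2 * (B / 2 + 1))"
        unfolding s(1) by (simp add: power2_eq_square algebra_simps)
      moreover have "s\<^sup>2 * (B / 2 + 1) > 0"
        using B s(2) by (intro mult_pos_pos) auto
      ultimately show False using pos[of "- s"] by simp
    qed
    then show ?thesis by (simp add: A_def)
  qed
  then have "poisson F u g"
    unfolding poisson_def H10_def using u g \<phi>(1) by (auto simp: L_def)
  then show ?thesis by (rule that)
qed

section \<open>Weak comparison, the slab barrier and L2 stability\<close>

lemma space_M [simp]: "space M = \<Omega>"
  by (simp add: space_restrict_space)

text \<open>The test function \<open>v k\<close> plays the role of \<open>(\<phi> k - \<psi> k)\<^sup>+\<close>. Since the derivative of
  \<^const>\<open>smooth_pos\<close> lies between 0 and 1, \<open>|\<nabla>v|\<^sup>2 \<le> \<nabla>(\<phi> - \<psi>) \<bullet> \<nabla>v\<close>, which forces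
  \<open>\<nabla>v k\<close> to vanish in the limit.\<close>

lemma comparison:
  fixes \<phi> \<psi> v :: "nat \<Rightarrow> 'a \<Rightarrow> real"
  assumes sm: "\<And>k. smooth_fun (\<phi> k)" "\<And>k. smooth_fun (\<psi> k)"
    and v: "\<And>k. test_fun \<Omega> (v k)" "\<And>k x. x \<in> \<Omega> \<Longrightarrow> v k x = smooth_pos (e k) (\<phi> k x - \<psi> k x)"
    and e: "\<And>k. e k > 0" "e \<longlonglongrightarrow> 0"
    and sq: "sq_int M u" "sq_int M g" "sq_int M u'" "sq_int M g'"
    and lim: "(\<lambda>k. sq_norm M (\<lambda>x. \<phi> k x - u x)) \<longlonglongrightarrow> 0"
      "(\<lambda>k. sq_norm M (\<lambda>x. grad (\<phi> k) x - g x)) \<longlonglongrightarrow> 0"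
      "(\<lambda>k. sq_norm M (\<lambda>x. \<psi> k x - u' x)) \<longlonglongrightarrow> 0"
      "(\<lambda>k. sq_norm M (\<lambda>x. grad (\<psi> k) x - g' x)) \<longlonglongrightarrow> 0"
    and le: "\<And>w. test_fun \<Omega> w \<Longrightarrow> (\<And>x. x \<in> \<Omega> \<Longrightarrow> 0 \<le> w x) \<Longrightarrow> (LINT x|M. (g x - g' x) \<bullet> grad w x) \<le> 0"
  shows "AE x in M. u x \<le> u' x"
proof -
  obtain C where C: "C > 0" "\<And>\<phi>. test_fun \<Omega> \<phi> \<Longrightarrow> sq_norm M \<phi> \<le> C * sq_norm M (grad \<phi>)"
    using poincare by blast
  define D where "D k x = grad (\<phi> k) x - grad (\<psi> k) x" for k x
  define N where "N k = sq_norm M (\<lambda>x. D k x - (g x - g' x))" for k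
  have D: "sq_int M (D k)" for k
    unfolding D_def using sm by (intro sq_int_diff sq_int_grad)
  have N: "N \<longlonglongrightarrow> 0"
    unfolding N_def D_def using lim sq sm by (intro tendsto_sq_norm_diff sq_int_grad)
  have sv: "smooth_fun (v k)" for k using v(1) by (rule test_fun_smooth)
  have v_nonneg: "0 \<le> v k x" if "x \<in> \<Omega>" for k x
    using v(2)[OF that] by (simp add: smooth_pos_nonneg)
  have grad_v: "grad (v k) x = smooth_pos' (e k) (\<phi> k x - \<psi> k x) *\<^sub>R D k x" if "x \<in> \<Omega>" for k x
  proof -
    have "grad (v k) x = grad (\<lambda>x. smooth_pos (e k) (\<phi> k x - \<psi> k x)) x"
      using open_\<Omega> that v(2) sm e by (intro grad_cong_open[of \<Omega>] smooth_fun_smooth_pos smooth_fun_diff) auto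
    then show ?thesis
      using sm e by (simp add: grad_smooth_pos smooth_fun_diff grad_diff D_def)
  qed
  have grad_v_le: "sq_norm M (grad (v k)) \<le> N k" for k
  proof -
    have "sq_norm M (grad (v k)) \<le> (LINT x|M. D k x \<bullet> grad (v k) x)"
    proof (rule integral_mono)
      fix x assume "x \<in> space M"
      then have x: "x \<in> \<Omega>" by simp
      define s where "s = smooth_pos' (e k) (\<phi> k x - \<psi> k x)"
      have s: "0 \<le> s" "s \<le> 1" using smooth_pos'_bounds e by (auto simp: s_def)
      have "s * s \<le> s * 1" using s by (intro mult_left_mono)
      then have "s * s * (D k x \<bullet> D k x) \<le> s * (D k x \<bullet> D k x)"
        by (intro mult_right_mono) auto
      then show "(norm (grad (v k) x))\<^sup>2 \<le> D k x \<bullet> grad (v k) x"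
        unfolding power2_norm_eq_inner grad_v[OF x] s_def[symmetric] by (simp add: mult.assoc)
    qed (use sq_int_grad[OF sv] D in \<open>auto intro: sq_int_integrable integrable_inner_sq_int\<close>)
    also have "\<dots> = (LINT x|M. (D k x - (g x - g' x)) \<bullet> grad (v k) x) + (LINT x|M. (g x - g' x) \<bullet> grad (v k) x)"
    proof -
      have "(LINT x|M. D k x \<bullet> grad (v k) x)
          = (LINT x|M. (D k x - (g x - g' x)) \<bullet> grad (v k) x + (g x - g' x) \<bullet> grad (v k) x)"
        by (simp flip: inner_add_left)
      also have "\<dots> = (LINT x|M. (D k x - (g x - g' x)) \<bullet> grad (v k) x) + (LINT x|M. (g x - g' x) \<bullet> grad (v k) x)"
        using D sq sq_int_grad[OF sv]
        by (intro Bochner_Integration.integral_add integrable_inner_sq_int sq_int_diff)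
      finally show ?thesis .
    qed
    also have "\<dots> \<le> (LINT x|M. (D k x - (g x - g' x)) \<bullet> grad (v k) x)"
      using le[OF v(1) v_nonneg] by simp
    \<comment> \<open>Weight 1/2 returns half of the left-hand side, so absorbing it leaves exactly
      \<open>N k\<close>.\<close>
    also have "\<dots> \<le> 1/2 * N k + sq_norm M (grad (v k)) / (4 * (1/2))"
      unfolding N_def
      by (rule order_trans[OF abs_ge_self integral_inner_le_weighted])
        (use D sq sq_int_grad[OF sv] in \<open>auto intro: sq_int_diff\<close>)
    finally show ?thesis by simp
  qed
  define w where "w x = max 0 (u x - u' x)" for x
  \<comment> \<open>Four errors are collected: u - u' \<le> (u - \<phi> k) + (\<psi> k - u') + v k +
    e k, and the square of a sum of four terms is at most 4 times the sum of the squares. The bound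
    \<open>C * N k\<close> for \<open>v k\<close> is Poincare combined with
    \<open>grad_v_le\<close>.\<close>
  define Q where "Q k = 4 * (sq_norm M (\<lambda>x. \<phi> k x - u x) + sq_norm M (\<lambda>x. \<psi> k x - u' x)
    + C * N k + (e k)\<^sup>2 * measure M (space M))" for k
  have w_sq: "sq_int M w"
  proof (rule sq_int_bound)
    show "integrable M (\<lambda>x. (norm (u x - u' x))\<^sup>2)"
      using sq by (intro sq_int_integrable sq_int_diff)
    show "AE x in M. (norm (w x))\<^sup>2 \<le> (norm (u x - u' x))\<^sup>2"
      by (intro AE_I2 power_mono) (auto simp: w_def)
    show "w \<in> borel_measurable M"
      unfolding w_def using sq by (auto simp: sq_int_def)
  qed
  have w_le: "sq_norm M w \<le> Q k" for k
  proof -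
    have i: "integrable M (\<lambda>x. (norm (\<phi> k x - u x))\<^sup>2)" "integrable M (\<lambda>x. (norm (\<psi> k x - u' x))\<^sup>2)"
      "integrable M (\<lambda>x. (norm (v k x))\<^sup>2)"
      using sq sq_int_smooth[OF sm(1)] sq_int_smooth[OF sm(2)] sq_int_smooth[OF sv]
      by (intro sq_int_integrable sq_int_diff; simp)+
    have "sq_norm M w \<le> (LINT x|M. 4 * ((norm (\<phi> k x - u x))\<^sup>2 + (norm (\<psi> k x - u' x))\<^sup>2 + (norm (v k x))\<^sup>2 + (e k)\<^sup>2))"
    proof (rule integral_mono)
      show "integrable M (\<lambda>x. 4 * ((norm (\<phi> k x - u x))\<^sup>2 + (norm (\<psi> k x - u' x))\<^sup>2 + (norm (v k x))\<^sup>2 + (e k)\<^sup>2))"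
        using i by (intro integrable_mult_right Bochner_Integration.integrable_add) auto
      fix x assume "x \<in> space M"
      then have x: "x \<in> \<Omega>" by simp
      define a b c d where "a = u x - \<phi> k x" and "b = \<psi> k x - u' x" and "c = v k x" and "d = e k"
      have "u x - u' x \<le> a + b + c + d"
        using smooth_pos_ge[OF e(1), of "\<phi> k x - \<psi> k x" k] v(2)[OF x, of k]
        by (simp add: a_def b_def c_def d_def)
      then have "w x \<le> \<bar>a + b + c + d\<bar>" "0 \<le> w x" by (auto simp: w_def)
      then have "(w x)\<^sup>2 \<le> (a + b + c + d)\<^sup>2"
        using power_mono[of "w x" "\<bar>a + b + c + d\<bar>" 2] by simp
      also have "\<dots> \<le> 4 * (a\<^sup>2 + b\<^sup>2 + c\<^sup>2 + d\<^sup>2)"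
      proof -
        have "0 \<le> (a - b)\<^sup>2 + (a - c)\<^sup>2 + (a - d)\<^sup>2 + (b - c)\<^sup>2 + (b - d)\<^sup>2 + (c - d)\<^sup>2" by simp
        then show ?thesis by (simp add: power2_eq_square algebra_simps)
      qed
      also have "\<dots> = 4 * ((norm (\<phi> k x - u x))\<^sup>2 + (norm (\<psi> k x - u' x))\<^sup>2 + (norm (v k x))\<^sup>2 + (e k)\<^sup>2)"
        by (simp add: a_def b_def c_def d_def power2_commute)
      finally show "(norm (w x))\<^sup>2 \<le> \<dots>" by simp
    qed (use w_sq in \<open>rule sq_int_integrable\<close>)
    also have "\<dots> = 4 * (sq_norm M (\<lambda>x. \<phi> k x - u x) + sq_norm M (\<lambda>x. \<psi> k x - u' x)
        + sq_norm M (v k) + (e k)\<^sup>2 * measure M (space M))"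
      using i by simp
    also have "sq_norm M (v k) \<le> C * N k"
      using C(2)[OF v(1), of k] mult_left_mono[OF grad_v_le[of k], of C] C(1) by linarith
    finally show ?thesis by (simp add: Q_def)
  qed
  have "Q \<longlonglongrightarrow> 4 * (0 + 0 + C * 0 + 0\<^sup>2 * measure M (space M))"
    unfolding Q_def by (intro tendsto_intros lim N e)
  then have "sq_norm M w \<le> 0"
    using w_le by (intro LIMSEQ_le_const[of Q]) auto
  then have "sq_norm M w = 0" using sq_norm_nonneg[of M w] by linarith
  then have "AE x in M. (norm (w x))\<^sup>2 = 0"
    using integral_nonneg_eq_0_iff_AE[OF sq_int_integrable[OF w_sq]] by simp
  then show ?thesis
    by eventually_elim (auto simp: w_def)
qed

text \<open>Both solutions are approximated by test functions, so the smooth positive part of the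
  difference is itself a test function and \<open>comparison\<close> applies to the two equations
  subtracted.\<close>

lemma poisson_mono:
  assumes "poisson F u g" "poisson F' u' g'" "sq_int M F" "sq_int M F'" "AE x in M. F x \<le> F' x"
  shows "AE x in M. u x \<le> u' x"
proof -
  have h: "H10 u g" "H10 u' g'" using assms by (auto simp: poisson_def)
  obtain \<phi> where \<phi>: "\<And>k. test_fun \<Omega> (\<phi> k)" "\<And>k. smooth_fun (\<phi> k)"
    "(\<lambda>k. sq_norm M (\<lambda>x. \<phi> k x - u x)) \<longlonglongrightarrow> 0"
    "(\<lambda>k. sq_norm M (\<lambda>x. grad (\<phi> k) x - g x)) \<longlonglongrightarrow> 0"
    using H10_approx[OF h(1)] by blast
  obtain \<psi> where \<psi>: "\<And>k. test_fun \<Omega> (\<psi> k)" "\<And>k. smooth_fun (\<psi> k)"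
    "(\<lambda>k. sq_norm M (\<lambda>x. \<psi> k x - u' x)) \<longlonglongrightarrow> 0"
    "(\<lambda>k. sq_norm M (\<lambda>x. grad (\<psi> k) x - g' x)) \<longlonglongrightarrow> 0"
    using H10_approx[OF h(2)] by blast
  have sq: "sq_int M u" "sq_int M g" "sq_int M u'" "sq_int M g'"
    using h by (auto simp: H10_def)
  show ?thesis
  proof (rule comparison[of \<phi> \<psi> _ "\<lambda>k. inverse (real (Suc k))", OF \<phi>(2) \<psi>(2) _ _ _ _ sq \<phi>(3,4) \<psi>(3,4)])
    show "test_fun \<Omega> (\<lambda>x. smooth_pos (inverse (real (Suc k))) (\<phi> k x - \<psi> k x))" for k
      using \<phi>(1) \<psi>(1) by (intro test_fun_smooth_pos test_fun_diff) auto
    show "(\<lambda>k. inverse (real (Suc k))) \<longlonglongrightarrow> 0" by (rule LIMSEQ_inverse_real_of_nat)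
    fix w assume w: "test_fun \<Omega> w" "\<And>x. x \<in> \<Omega> \<Longrightarrow> 0 \<le> w x"
    have sw: "smooth_fun w" using w(1) by (rule test_fun_smooth)
    have "(LINT x|M. (g x - g' x) \<bullet> grad w x) = (LINT x|M. g x \<bullet> grad w x) - (LINT x|M. g' x \<bullet> grad w x)"
      using sq sq_int_grad[OF sw] by (simp add: inner_diff_left integrable_inner_sq_int)
    also have "\<dots> = (LINT x|M. F x * w x) - (LINT x|M. F' x * w x)"
      using assms(1,2) w(1) by (simp add: poisson_def)
    also have "\<dots> \<le> 0"
    proof -
      have "(LINT x|M. F x * w x) \<le> (LINT x|M. F' x * w x)"
      proof (rule integral_mono_AE)
        show "AE x in M. F x * w x \<le> F' x * w x"
          using assms(5) AE_space[of M]
          by eventually_elim (auto intro: mult_right_mono w(2))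
      qed (use assms sw in \<open>auto intro: integrable_mult_test\<close>)
      then show ?thesis by simp
    qed
    finally show "(LINT x|M. (g x - g' x) \<bullet> grad w x) \<le> 0" .
  qed auto
qed

lemma poisson_0: "poisson (\<lambda>x. 0) (\<lambda>x. 0) (\<lambda>x. 0)"
  unfolding poisson_def H10_def
  by (auto simp: sq_int_def grad_const intro!: exI[of _ "\<lambda>k x. 0"] test_fun_0)

lemma poisson_nonneg:
  assumes "poisson F u g" "sq_int M F" "AE x in M. 0 \<le> F x"
  shows "AE x in M. 0 \<le> u x"
  using poisson_mono[OF poisson_0 assms(1) _ assms(2,3)] by (simp add: sq_int_def)

text \<open>Where \<phi> vanishes inside \<Omega>, the argument \<phi> - w is nonpositive and the
  truncation is 0, so the support stays inside that of \<phi>. The barrier can be negative outside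
  \<Omega>, hence the cut-off by \<open>if\<close>; smoothness is glued from the open sets \<Omega>
  and the complement of the support of \<phi>.\<close>

lemma test_fun_truncation:
  assumes \<phi>: "test_fun \<Omega> \<phi>" and w: "smooth_fun w" "\<And>x. x \<in> \<Omega> \<Longrightarrow> 0 \<le> w x" and "e > 0"
  shows "test_fun \<Omega> (\<lambda>x. if x \<in> \<Omega> then smooth_pos e (\<phi> x - w x) else 0)"
proof -
  obtain S where S: "compact S" "S \<subseteq> \<Omega>" "\<And>x. x \<notin> S \<Longrightarrow> \<phi> x = 0"
    using test_funE[OF \<phi>] by metis
  let ?v = "\<lambda>x. if x \<in> \<Omega> then smooth_pos e (\<phi> x - w x) else 0"
  have z: "?v x = 0" if "x \<notin> S" for x
    using S(3)[OF that] w(2) by (auto intro: smooth_pos_eq_0)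
  have "smooth_fun ?v"
  proof (rule smooth_fun_local)
    fix x
    show "\<exists>T g. open T \<and> x \<in> T \<and> smooth_fun g \<and> (\<forall>y\<in>T. ?v y = g y)"
    proof (cases "x \<in> \<Omega>")
      case True
      then show ?thesis
        using open_\<Omega> smooth_fun_smooth_pos[OF \<open>e > 0\<close> smooth_fun_diff[OF test_fun_smooth[OF \<phi>] w(1)]]
        by (intro exI[of _ \<Omega>] exI[of _ "\<lambda>x. smooth_pos e (\<phi> x - w x)"]) auto
    next
      case False
      then show ?thesis
        using S z by (intro exI[of _ "- S"] exI[of _ "\<lambda>x. 0"])
          (auto simp: smooth_fun_const compact_imp_closed open_Compl)
    qed
  qed
  then show ?thesis using S z by (intro test_funI[of _ S])
qed

lemma poisson_slab_bound:
  assumes p: "poisson F u g" and F: "sq_int M F" "AE x in M. F x \<le> K" "0 \<le> K"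
    and a: "norm a = 1" and slab: "\<And>x. x \<in> \<Omega> \<Longrightarrow> b1 \<le> a \<bullet> x \<and> a \<bullet> x \<le> b2"
  shows "AE x in M. u x \<le> K * (b2 - b1)\<^sup>2 / 8"
proof -
  define w where "w x = (K / 2 * (b2 - a \<bullet> x)) * (a \<bullet> x - b1)" for x
  \<comment> \<open>The slope of w in direction a. Its own derivative in that direction is -K, so
    the barrier satisfies -\<Delta>w = K, which integration by parts against q expresses
    weakly.\<close>
  define q where "q x = K / 2 * (b1 + b2) - K * (a \<bullet> x)" for x
  have sw: "smooth_fun w" and sq: "smooth_fun q"
    unfolding w_def q_def by (intro smooth_fun_mult smooth_fun_diff smooth_fun_const smooth_fun_inner)+
  have gw: "grad w x = q x *\<^sub>R a" for x
    unfolding w_def q_def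
    by (rule gradI) (auto intro!: derivative_eq_intros simp: fun_eq_iff field_simps)
  have gq: "grad q x = - K *\<^sub>R a" for x
    unfolding q_def by (rule gradI) (auto intro!: derivative_eq_intros)
  have w_nonneg: "0 \<le> w x" if "x \<in> \<Omega>" for x
    using slab[OF that] F(3) by (simp add: w_def)
  have h: "H10 u g" using p by (simp add: poisson_def)
  obtain \<phi> where \<phi>: "\<And>k. test_fun \<Omega> (\<phi> k)" "\<And>k. smooth_fun (\<phi> k)"
    "(\<lambda>k. sq_norm M (\<lambda>x. \<phi> k x - u x)) \<longlonglongrightarrow> 0"
    "(\<lambda>k. sq_norm M (\<lambda>x. grad (\<phi> k) x - g x)) \<longlonglongrightarrow> 0"
    using H10_approx[OF h] by blast
  have ug: "sq_int M u" "sq_int M g" using h by (auto simp: H10_def)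
  have "AE x in M. u x \<le> w x"
  proof (rule comparison[of \<phi> "\<lambda>_. w" _ "\<lambda>k. inverse (real (Suc k))", OF \<phi>(2) sw _ _ _ _
        ug sq_int_smooth[OF sw] sq_int_grad[OF sw] \<phi>(3,4)])
    show "test_fun \<Omega> (\<lambda>x. if x \<in> \<Omega> then smooth_pos (inverse (real (Suc k))) (\<phi> k x - w x) else 0)" for k
      using \<phi>(1) sw w_nonneg by (intro test_fun_truncation) auto
    show "(\<lambda>k. inverse (real (Suc k))) \<longlonglongrightarrow> 0" by (rule LIMSEQ_inverse_real_of_nat)
    fix \<theta> assume \<theta>: "test_fun \<Omega> \<theta>" "\<And>x. x \<in> \<Omega> \<Longrightarrow> 0 \<le> \<theta> x"
    have st: "smooth_fun \<theta>" using \<theta>(1) by (rule test_fun_smooth)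
    have "(LINT x|M. (g x - grad w x) \<bullet> grad \<theta> x) = (LINT x|M. g x \<bullet> grad \<theta> x) - (LINT x|M. grad w x \<bullet> grad \<theta> x)"
      using ug sq_int_grad[OF sw] sq_int_grad[OF st] by (simp add: inner_diff_left integrable_inner_sq_int)
    also have "(LINT x|M. g x \<bullet> grad \<theta> x) = (LINT x|M. F x * \<theta> x)"
      using p \<theta>(1) by (simp add: poisson_def)
    also have "(LINT x|M. grad w x \<bullet> grad \<theta> x) = (LINT x|M. q x * (grad \<theta> x \<bullet> a))"
      by (simp add: gw inner_commute)
    also have "\<dots> = - (LINT x|M. \<theta> x * (grad q x \<bullet> a))"
      using \<theta>(1) sq by (rule integration_by_parts)
    also have "\<dots> = (LINT x|M. K * \<theta> x)"
      using a by (simp add: gq norm_eq_1 mult.commute)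
    also have "(LINT x|M. F x * \<theta> x) - (LINT x|M. K * \<theta> x) \<le> 0"
    proof -
      have "(LINT x|M. F x * \<theta> x) \<le> (LINT x|M. K * \<theta> x)"
      proof (rule integral_mono_AE)
        show "AE x in M. F x * \<theta> x \<le> K * \<theta> x"
          using F(2) AE_space[of M]
          by eventually_elim (auto intro: mult_right_mono \<theta>(2))
        show "integrable M (\<lambda>x. K * \<theta> x)"
          using st by (intro fin.sq_int_imp_integrable sq_int_smooth smooth_fun_mult smooth_fun_const)
      qed (use F st in \<open>auto intro: integrable_mult_test\<close>)
      then show ?thesis by simp
    qed
    finally show "(LINT x|M. (g x - grad w x) \<bullet> grad \<theta> x) \<le> 0" .
  qed auto
  note u_le_w = this
  have w_le: "w x \<le> K * (b2 - b1)\<^sup>2 / 8" for x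
  proof -
    \<comment> \<open>The product of the distances to the two faces is at most a quarter of the
      squared width, with equality on the middle hyperplane. Together with the factor K/2 this gives
      the 8.\<close>
    have "0 \<le> K / 2 * (((b2 - a \<bullet> x) - (a \<bullet> x - b1))\<^sup>2 / 4)" using F(3) by simp
    then show ?thesis by (simp add: w_def power2_eq_square field_simps)
  qed
  show ?thesis using u_le_w by eventually_elim (meson order_trans w_le)
qed

text \<open>The energy estimate for the difference of two solutions, followed by Poincare. The
  constant is fixed before the data, since it depends only on \<Omega>, and so serves a whole
  sequence of problems.\<close>

lemma poisson_stable:
  obtains C where "\<And>F F' u u' g g'. poisson F u g \<Longrightarrow> poisson F' u' g' \<Longrightarrow> sq_int M F \<Longrightarrow> sq_int M F'
    \<Longrightarrow> sq_norm M (\<lambda>x. u x - u' x) \<le> C * sq_norm M (\<lambda>x. F x - F' x)"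
proof -
  obtain C where C: "C > 0" "\<And>\<phi>. test_fun \<Omega> \<phi> \<Longrightarrow> sq_norm M \<phi> \<le> C * sq_norm M (grad \<phi>)"
    using poincare by blast
  have "sq_norm M (\<lambda>x. u x - u' x) \<le> (4 * C\<^sup>2) * sq_norm M (\<lambda>x. F x - F' x)"
    if p: "poisson F u g" "poisson F' u' g'" and F: "sq_int M F" "sq_int M F'" for F F' u u' g g'
  proof -
    have h: "H10 u g" "H10 u' g'" using p by (auto simp: poisson_def)
    obtain \<phi> where \<phi>: "\<And>k. test_fun \<Omega> (\<phi> k)" "\<And>k. smooth_fun (\<phi> k)"
      "(\<lambda>k. sq_norm M (\<lambda>x. \<phi> k x - u x)) \<longlonglongrightarrow> 0"
      "(\<lambda>k. sq_norm M (\<lambda>x. grad (\<phi> k) x - g x)) \<longlonglongrightarrow> 0"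
      using H10_approx[OF h(1)] by blast
    obtain \<psi> where \<psi>: "\<And>k. test_fun \<Omega> (\<psi> k)" "\<And>k. smooth_fun (\<psi> k)"
      "(\<lambda>k. sq_norm M (\<lambda>x. \<psi> k x - u' x)) \<longlonglongrightarrow> 0"
      "(\<lambda>k. sq_norm M (\<lambda>x. grad (\<psi> k) x - g' x)) \<longlonglongrightarrow> 0"
      using H10_approx[OF h(2)] by blast
    have sq: "sq_int M u" "sq_int M g" "sq_int M u'" "sq_int M g'"
      using h by (auto simp: H10_def)
    define D where "D k x = \<phi> k x - \<psi> k x" for k x
    define e where "e k = sq_norm M (\<lambda>x. (grad (\<phi> k) x - grad (\<psi> k) x) - (g x - g' x))" for k
    define d where "d k = sq_norm M (\<lambda>x. (\<phi> k x - \<psi> k x) - (u x - u' x))" for k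
    define N where "N = sq_norm M (\<lambda>x. F x - F' x)"
    have D: "test_fun \<Omega> (D k)" for k
      unfolding D_def using \<phi>(1) \<psi>(1) by (rule test_fun_diff)
    have sD: "smooth_fun (D k)" for k using D by (rule test_fun_smooth)
    have gD: "grad (D k) x = grad (\<phi> k) x - grad (\<psi> k) x" for k x
      unfolding D_def using \<phi>(2) \<psi>(2) by (simp add: grad_diff)
    have e: "e \<longlonglongrightarrow> 0"
      unfolding e_def using \<phi> \<psi> sq by (intro tendsto_sq_norm_diff sq_int_grad)
    have d: "d \<longlonglongrightarrow> 0"
      unfolding d_def using \<phi>(3) \<psi>(3) sq sq_int_smooth[OF \<phi>(2)] sq_int_smooth[OF \<psi>(2)]
      by (intro tendsto_sq_norm_diff)
    have "sq_norm M (\<lambda>x. u x - u' x) \<le> 2 * (C * (2 * e k + 2 * (C * N))) + 2 * d k" for k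
    proof -
      define a where "a = sq_norm M (grad (D k))"
      note sg = sq_int_grad[OF sD, of k]
      have "a = (LINT x|M. (grad (D k) x - (g x - g' x)) \<bullet> grad (D k) x + (g x - g' x) \<bullet> grad (D k) x)"
        unfolding a_def power2_norm_eq_inner by (simp flip: inner_add_left)
      also have "\<dots> = (LINT x|M. (grad (D k) x - (g x - g' x)) \<bullet> grad (D k) x)
          + (LINT x|M. (g x - g' x) \<bullet> grad (D k) x)"
        using sg sq by (intro Bochner_Integration.integral_add integrable_inner_sq_int sq_int_diff)
      also have "(LINT x|M. (g x - g' x) \<bullet> grad (D k) x)
          = (LINT x|M. g x \<bullet> grad (D k) x) - (LINT x|M. g' x \<bullet> grad (D k) x)"
        using sq sg by (simp add: inner_diff_left integrable_inner_sq_int)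
      also have "\<dots> = (LINT x|M. F x * D k x) - (LINT x|M. F' x * D k x)"
        using p D by (simp add: poisson_def)
      also have "\<dots> = (LINT x|M. (F x - F' x) \<bullet> D k x)"
        using F sD by (simp add: left_diff_distrib integrable_mult_test)
      \<comment> \<open>The weights 1 here and C below each leave a quarter of a on the right (for C
        by Poincare). Half of a is absorbed, and one more use of Poincare produces the constant
        \<open>4 * C\<^sup>2\<close>.\<close>
      also have "(LINT x|M. (grad (D k) x - (g x - g' x)) \<bullet> grad (D k) x) \<le> 1 * e k + a / (4 * 1)"
        unfolding e_def a_def gD[symmetric]
        by (rule order_trans[OF abs_ge_self integral_inner_le_weighted])
          (use sg sq in \<open>auto intro: sq_int_diff\<close>)
      also have "(LINT x|M. (F x - F' x) \<bullet> D k x) \<le> C * N + sq_norm M (D k) / (4 * C)"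
        unfolding N_def
        by (rule order_trans[OF abs_ge_self integral_inner_le_weighted])
          (use F C sq_int_smooth[OF sD] in \<open>auto intro: sq_int_diff\<close>)
      also have "sq_norm M (D k) / (4 * C) \<le> a / 4"
        using C(2)[OF D, of k] C(1) by (simp add: a_def field_simps)
      finally have "a \<le> 2 * e k + 2 * (C * N)" by simp
      then have "C * a \<le> C * (2 * e k + 2 * (C * N))"
        using C(1) by (intro mult_left_mono) auto
      moreover have "sq_norm M (D k) \<le> C * a"
        using C(2)[OF D, of k] by (simp add: a_def)
      moreover have "sq_norm M (\<lambda>x. u x - u' x) \<le> 2 * sq_norm M (D k) + 2 * d k"
      proof -
        have "sq_norm M (\<lambda>x. u x - u' x) = sq_norm M (\<lambda>x. D k x - (D k x - (u x - u' x)))" by simp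
        also have "\<dots> \<le> 2 * sq_norm M (D k) + 2 * sq_norm M (\<lambda>x. D k x - (u x - u' x))"
          using sq sq_int_smooth[OF sD] by (intro sq_norm_diff_le sq_int_diff)
        finally show ?thesis by (simp add: d_def D_def)
      qed
      ultimately show ?thesis by linarith
    qed
    moreover have "(\<lambda>k. 2 * (C * (2 * e k + 2 * (C * N))) + 2 * d k) \<longlonglongrightarrow> 2 * (C * (2 * 0 + 2 * (C * N))) + 2 * 0"
      by (intro tendsto_intros e d)
    ultimately have "sq_norm M (\<lambda>x. u x - u' x) \<le> 2 * (C * (2 * 0 + 2 * (C * N))) + 2 * 0"
      by (intro LIMSEQ_le_const) auto
    then show ?thesis by (simp add: N_def power2_eq_square)
  qed
  then show ?thesis by (rule that)
qed

end

section \<open>Essential bounds\<close>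

lemma (in finite_measure) tendsto_sq_norm_dominated:
  fixes s :: "nat \<Rightarrow> 'a \<Rightarrow> real"
  assumes [measurable]: "\<And>n. s n \<in> borel_measurable M" "l \<in> borel_measurable M"
    and bound: "\<And>n. AE x in M. \<bar>s n x\<bar> \<le> B" and lim: "AE x in M. (\<lambda>n. s n x) \<longlonglongrightarrow> l x"
  shows "(\<lambda>n. sq_norm M (\<lambda>x. s n x - l x)) \<longlonglongrightarrow> 0"
proof -
  have l: "AE x in M. \<bar>l x\<bar> \<le> B"
  proof -
    have "AE x in M. \<forall>n. \<bar>s n x\<bar> \<le> B" using bound by (simp add: AE_all_countable)
    then show ?thesis using lim
      by eventually_elim (auto intro: LIMSEQ_le_const2[OF tendsto_rabs])
  qed
  have "(\<lambda>n. LINT x|M. (norm (s n x - l x))\<^sup>2) \<longlonglongrightarrow> (LINT x|M. 0)"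
  proof (rule integral_dominated_convergence)
    show "integrable M (\<lambda>x. (2 * B)\<^sup>2)" by simp
    show "AE x in M. (\<lambda>n. (norm (s n x - l x))\<^sup>2) \<longlonglongrightarrow> 0"
      using lim
    proof eventually_elim
      case (elim x)
      have "(\<lambda>n. (norm (s n x - l x))\<^sup>2) \<longlonglongrightarrow> (norm (l x - l x))\<^sup>2"
        by (intro tendsto_intros elim)
      then show ?case by simp
    qed
    show "AE x in M. norm ((norm (s n x - l x))\<^sup>2) \<le> (2 * B)\<^sup>2" for n
      using bound[of n] l
    proof eventually_elim
      case (elim x)
      then have "\<bar>s n x - l x\<bar> \<le> 2 * B" by linarith
      then have "\<bar>s n x - l x\<bar>\<^sup>2 \<le> (2 * B)\<^sup>2" by (intro power_mono) auto
      then show ?case by simp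
    qed
  qed auto
  then show ?thesis by simp
qed

context bounded_open_set
begin

text \<open>The infimum of the essential bounds is attained: each Inf X + 1/(n+1) is exceeded only
  on a null set, and a countable union of null sets is null.\<close>

lemma AE_le_Linf_norm:
  assumes "Linf_on \<Omega> u"
  shows "AE x in M. \<bar>u x\<bar> \<le> Linf_norm \<Omega> u"
proof -
  define X where "X = {M. AE x in lebesgue. x \<in> \<Omega> \<longrightarrow> \<bar>u x\<bar> \<le> M}"
  have "X \<noteq> {}" using assms by (auto simp: X_def Linf_on_def)
  have "AE x in M. \<bar>u x\<bar> \<le> Inf X + inverse (real (Suc n))" for n
  proof -
    obtain y where "y \<in> X" "y < Inf X + inverse (real (Suc n))"
      using cInf_lessD[OF \<open>X \<noteq> {}\<close>, of "Inf X + inverse (real (Suc n))"] by auto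
    then have "AE x in M. \<bar>u x\<bar> \<le> y" by (simp add: X_def AE_M_iff)
    then show ?thesis
      by eventually_elim (use \<open>y < _\<close> in linarith)
  qed
  then have "AE x in M. \<forall>n. \<bar>u x\<bar> \<le> Inf X + inverse (real (Suc n))"
    by (simp add: AE_all_countable)
  then show ?thesis
  proof eventually_elim
    case (elim x)
    have "(\<lambda>n. Inf X + inverse (real (Suc n))) \<longlonglongrightarrow> Inf X + 0"
      by (intro tendsto_add tendsto_const LIMSEQ_inverse_real_of_nat)
    then have "\<bar>u x\<bar> \<le> Inf X + 0" by (rule LIMSEQ_le_const) (use elim in auto)
    then show ?case by (simp add: Linf_norm_def X_def)
  qed
qed

text \<open>A nonempty open set is not negligible. For empty \<Omega> every real number would be an
  essential bound, and the infimum in \<open>Linf_norm\<close> would range over a set without lower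
  bound.\<close>

lemma essential_bound_nonneg:
  assumes "\<Omega> \<noteq> {}" "AE x in lebesgue. x \<in> \<Omega> \<longrightarrow> \<bar>u x\<bar> \<le> (y::real)"
  shows "0 \<le> y"
proof (rule ccontr)
  assume "\<not> 0 \<le> y"
  with assms(2) have "AE x in lebesgue. x \<notin> \<Omega>"
    by (auto elim!: eventually_mono)
  then have "\<Omega> \<in> null_sets lebesgue"
    using AE_iff_null_sets[OF \<Omega>_sets] by simp
  then have "negligible \<Omega>" by (simp add: negligible_iff_null_sets)
  then show False using open_not_negligible[OF open_\<Omega> assms(1)] by simp
qed

lemma Linf_norm_nonneg:
  assumes "\<Omega> \<noteq> {}" "Linf_on \<Omega> u"
  shows "0 \<le> Linf_norm \<Omega> u"
  using essential_bound_nonneg[OF assms(1)] AE_le_Linf_norm[OF assms(2)] by (simp add: AE_M_iff)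

lemma Linf_norm_le:
  assumes "\<Omega> \<noteq> {}" "AE x in M. \<bar>u x\<bar> \<le> y"
  shows "Linf_norm \<Omega> u \<le> y"
  unfolding Linf_norm_def
proof (rule cInf_lower)
  show "y \<in> {M. AE x in lebesgue. x \<in> \<Omega> \<longrightarrow> \<bar>u x\<bar> \<le> M}" using assms(2) by (simp add: AE_M_iff)
  show "bdd_below {M. AE x in lebesgue. x \<in> \<Omega> \<longrightarrow> \<bar>u x\<bar> \<le> M}"
    using essential_bound_nonneg[OF assms(1)] by (intro bdd_belowI[of _ 0]) auto
qed

text \<open>The infimum over slabs is approached through slabs of width below Inf X + 1/(n+1). Each
  contributes one exceptional null set, and the countably many bounds are passed to the limit
  pointwise.\<close>

lemma poisson_slab_diam_bound:
  assumes "\<Omega> \<noteq> {}" "poisson F u g" "sq_int M F" "AE x in M. F x \<le> K" "0 \<le> K"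
  shows "AE x in M. u x \<le> K * (slab_diam \<Omega>)\<^sup>2 / 8"
proof -
  define X where "X = {b2 - b1 | a b1 b2. norm a = 1 \<and> \<Omega> \<subseteq> {x. b1 \<le> a \<bullet> x \<and> a \<bullet> x \<le> b2}}"
  obtain R where R: "\<And>x. x \<in> \<Omega> \<Longrightarrow> norm x \<le> R"
    using bounded_\<Omega> by (auto simp: bounded_iff)
  have "R - (- R) \<in> X"
  proof -
    define a :: 'a where "a = (SOME i. i \<in> Basis)"
    have a: "norm a = 1" by (simp add: a_def some_in_eq)
    have "\<bar>a \<bullet> x\<bar> \<le> R" if "x \<in> \<Omega>" for x
      using Cauchy_Schwarz_ineq2[of a x] a R[OF that] by simp
    then have "\<Omega> \<subseteq> {x. - R \<le> a \<bullet> x \<and> a \<bullet> x \<le> R}" by (auto simp: abs_le_iff minus_le_iff)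
    then show ?thesis using a unfolding X_def by blast
  qed
  then have ne: "X \<noteq> {}" by auto
  \<comment> \<open>A point of \<Omega> forces b1 \<le> b2. Nonnegative widths are what makes
    squaring monotone below.\<close>
  have nonneg: "0 \<le> y" if "y \<in> X" for y
    using that assms(1) unfolding X_def by force
  have D: "slab_diam \<Omega> = Inf X" by (simp add: slab_diam_def X_def)
  have "AE x in M. u x \<le> K * (Inf X + inverse (real (Suc n)))\<^sup>2 / 8" for n
  proof -
    obtain y where y: "y \<in> X" "y < Inf X + inverse (real (Suc n))"
      using cInf_lessD[OF ne, of "Inf X + inverse (real (Suc n))"] by auto
    then obtain a b1 b2 where ab: "y = b2 - b1" "norm a = 1" "\<Omega> \<subseteq> {x. b1 \<le> a \<bullet> x \<and> a \<bullet> x \<le> b2}"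
      unfolding X_def by blast
    have ae: "AE x in M. u x \<le> K * (b2 - b1)\<^sup>2 / 8"
      using assms ab by (intro poisson_slab_bound[of F u g K a]) auto
    have "(b2 - b1)\<^sup>2 \<le> (Inf X + inverse (real (Suc n)))\<^sup>2"
      using y nonneg[OF y(1)] ab(1) by (intro power_mono) auto
    then have le: "K * (b2 - b1)\<^sup>2 / 8 \<le> K * (Inf X + inverse (real (Suc n)))\<^sup>2 / 8"
      using assms(5) by (intro divide_right_mono mult_left_mono) auto
    show ?thesis using ae by eventually_elim (use le in linarith)
  qed
  then have "AE x in M. \<forall>n. u x \<le> K * (Inf X + inverse (real (Suc n)))\<^sup>2 / 8"
    by (simp add: AE_all_countable)
  then show ?thesis
  proof eventually_elim
    case (elim x)
    have "(\<lambda>n. K * (Inf X + inverse (real (Suc n)))\<^sup>2 / 8) \<longlonglongrightarrow> K * (Inf X + 0)\<^sup>2 / 8"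
      by (intro tendsto_add tendsto_const LIMSEQ_inverse_real_of_nat tendsto_divide tendsto_mult tendsto_power) auto
    then have "u x \<le> K * (Inf X + 0)\<^sup>2 / 8" by (rule LIMSEQ_le_const) (use elim in auto)
    then show ?case by (simp add: D)
  qed
qed

end

section \<open>Monotone iteration\<close>

text \<open>Monotonicity bounds f(s n) above by f(l); lower semicontinuity bounds it below by f(l) -
  r eventually.\<close>

lemma lsc_mono_tendsto:
  fixes f :: "real \<Rightarrow> real"
  assumes mono: "\<And>s t. 0 \<le> s \<Longrightarrow> s \<le> t \<Longrightarrow> f s \<le> f t" and lsc: "lsc_nonneg f"
    and s: "\<And>n. 0 \<le> s n" "\<And>n. s n \<le> l" "s \<longlonglongrightarrow> l"
  shows "(\<lambda>n. f (s n)) \<longlonglongrightarrow> f l"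
proof (rule LIMSEQ_I)
  fix r :: real assume "r > 0"
  have "0 \<le> l" using s(1,2)[of 0] by linarith
  then obtain \<delta> where \<delta>: "\<delta> > 0" "\<And>t. t \<ge> 0 \<Longrightarrow> \<bar>t - l\<bar> < \<delta> \<Longrightarrow> f l - r < f t"
    using lsc \<open>r > 0\<close> unfolding lsc_nonneg_def by blast
  obtain N where "\<And>n. n \<ge> N \<Longrightarrow> norm (s n - l) < \<delta>"
    using LIMSEQ_D[OF s(3) \<delta>(1)] by blast
  then have "norm (f (s n) - f l) < r" if "n \<ge> N" for n
    using \<delta>(2)[OF s(1), of n] mono[OF s(1,2), of n] that by force
  then show "\<exists>N. \<forall>n\<ge>N. norm (f (s n) - f l) < r" by blast
qed

context bounded_open_set
begin

text \<open>Allows the final solution to be changed on a null set so that it is nonnegative at every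
  point.\<close>

lemma H10_cong_AE:
  assumes "H10 u g" and [measurable]: "u' \<in> borel_measurable M" and ae: "AE x in M. u x = u' x"
  shows "H10 u' g"
proof -
  obtain \<phi> where \<phi>: "\<And>k. test_fun \<Omega> (\<phi> k)" "\<And>k. smooth_fun (\<phi> k)"
    "(\<lambda>k. sq_norm M (\<lambda>x. \<phi> k x - u x)) \<longlonglongrightarrow> 0"
    "(\<lambda>k. sq_norm M (\<lambda>x. grad (\<phi> k) x - g x)) \<longlonglongrightarrow> 0"
    using H10_approx[OF assms(1)] by blast
  have sq: "sq_int M u" "sq_int M g" using assms(1) by (auto simp: H10_def)
  have [measurable]: "u \<in> borel_measurable M" using sq by (simp add: sq_int_def)
  have [measurable]: "\<phi> k \<in> borel_measurable M" for k
    using sq_int_smooth[OF \<phi>(2)] by (simp add: sq_int_def)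
  have "sq_int M u'"
  proof (rule sq_int_bound)
    show "integrable M (\<lambda>x. (norm (u x))\<^sup>2)" using sq(1) by (rule sq_int_integrable)
    show "AE x in M. (norm (u' x))\<^sup>2 \<le> (norm (u x))\<^sup>2" using ae by eventually_elim simp
  qed simp
  moreover have "sq_norm M (\<lambda>x. \<phi> k x - u' x) = sq_norm M (\<lambda>x. \<phi> k x - u x)" for k
    by (rule integral_cong_AE) (use ae in \<open>auto elim!: eventually_mono\<close>)
  ultimately show ?thesis
    unfolding H10_def using \<phi> sq by (intro conjI exI[of _ \<phi>]) (simp_all del: real_norm_def)
qed

text \<open>Existence is reduced to one scalar inequality for B. Both growth regimes of the theorem
  then differ only in how B is found.\<close>

lemma semilinear_exists:
  fixes f :: "real \<Rightarrow> real"
  assumes ne: "\<Omega> \<noteq> {}"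
    and f_nonneg: "\<And>s. s \<ge> 0 \<Longrightarrow> f s \<ge> 0"
    and f_mono: "\<And>s t. 0 \<le> s \<Longrightarrow> s \<le> t \<Longrightarrow> f s \<le> f t" and f_lsc: "lsc_nonneg f"
    and [measurable]: "lam \<in> borel_measurable M" "h \<in> borel_measurable M"
    and lam: "AE x in M. 0 \<le> lam x \<and> lam x \<le> \<Lambda>" and h: "AE x in M. 0 \<le> h x \<and> h x \<le> H"
    and "0 \<le> \<Lambda>" "0 \<le> H" "0 \<le> B"
    and B: "(\<Lambda> * f B + H) * (slab_diam \<Omega>)\<^sup>2 / 8 \<le> B"
  obtains u where "weak_solution \<Omega> lam f h u" "u \<in> borel_measurable M"
    "\<And>x. 0 \<le> u x" "AE x in M. u x \<le> B"
proof -
  \<comment> \<open>Nothing is assumed about f on negative arguments. Freezing it there at f 0 gives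
    a function monotone on the whole line, hence Borel measurable.\<close>
  define f0 where "f0 s = f (max 0 s)" for s
  have f0_mono: "mono f0" unfolding f0_def by (intro monoI f_mono) auto
  then have [measurable]: "f0 \<in> borel_measurable borel" by (rule borel_measurable_mono)
  have f0_nonneg: "0 \<le> f0 s" for s by (simp add: f0_def f_nonneg)
  define A where "A = \<Lambda> * f B + H"
  have A: "0 \<le> A" using assms f_nonneg by (simp add: A_def)
  define rhs where "rhs u x = lam x * f0 (u x) + h x" for u :: "'a \<Rightarrow> real" and x
  have rhs_meas [measurable]: "rhs u \<in> borel_measurable M" if "u \<in> borel_measurable M" for u
    unfolding rhs_def using that by simp
  have rhs_bounds: "AE x in M. 0 \<le> rhs u x \<and> rhs u x \<le> A" if "AE x in M. u x \<le> B" for u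
    using that lam h
  proof eventually_elim
    case (elim x)
    have "f0 (u x) \<le> f B" unfolding f0_def using elim \<open>0 \<le> B\<close> by (intro f_mono) auto
    then have "lam x * f0 (u x) \<le> \<Lambda> * f B"
      using elim \<open>0 \<le> \<Lambda>\<close> f0_nonneg by (intro mult_mono) auto
    then show ?case using elim f0_nonneg by (simp add: rhs_def A_def)
  qed
  have rhs_abs: "AE x in M. \<bar>rhs u x\<bar> \<le> A" if "AE x in M. u x \<le> B" for u
    using rhs_bounds[OF that] by eventually_elim auto
  have rhs_sq: "sq_int M (rhs u)" if "u \<in> borel_measurable M" "AE x in M. u x \<le> B" for u
    using rhs_abs[OF that(2)] rhs_meas[OF that(1)] by (intro fin.sq_int_bounded[of _ A]) auto
  \<comment> \<open>The invariant of the iteration: an argument bounded by B has right-hand side at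
    most A, and the slab bound with \<open>B\<close> leads back below B.\<close>
  have sol: "u \<in> borel_measurable M" "AE x in M. 0 \<le> u x" "AE x in M. u x \<le> B"
    if "poisson (rhs w) u g" "w \<in> borel_measurable M" "AE x in M. w x \<le> B" for w u g
  proof -
    show "u \<in> borel_measurable M" using that(1) by (auto simp: poisson_def H10_def sq_int_def)
    show "AE x in M. 0 \<le> u x"
      using rhs_bounds[OF that(3)] by (intro poisson_nonneg[OF that(1) rhs_sq[OF that(2,3)]]) auto
    have "AE x in M. rhs w x \<le> A" using rhs_bounds[OF that(3)] by auto
    from poisson_slab_diam_bound[OF ne that(1) rhs_sq[OF that(2,3)] this A]
    show "AE x in M. u x \<le> B"
      by eventually_elim (use B in \<open>simp add: A_def\<close>)
  qed
  define step where "step w = (SOME u. \<exists>g. poisson (rhs w) u g)" for w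
  define U where "U n = (step ^^ n) (\<lambda>x. 0)" for n
  have step: "\<exists>g. poisson (rhs w) (step w) g" if "w \<in> borel_measurable M" "AE x in M. w x \<le> B" for w
  proof -
    have "\<exists>u g. poisson (rhs w) u g" using poisson_exists[OF rhs_sq[OF that]] by blast
    then show ?thesis unfolding step_def by (rule someI_ex)
  qed
  have U: "U n \<in> borel_measurable M \<and> (AE x in M. 0 \<le> U n x) \<and> (AE x in M. U n x \<le> B)" for n
  proof (induction n)
    case 0
    then show ?case using \<open>0 \<le> B\<close> by (simp add: U_def)
  next
    case (Suc n)
    then obtain g where "poisson (rhs (U n)) (step (U n)) g" using step by blast
    then have "poisson (rhs (U n)) (U (Suc n)) g" by (simp add: U_def)
    then show ?case using sol Suc by blast
  qed
  have U_meas [measurable]: "U n \<in> borel_measurable M" for n using U by blast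
  have U_nonneg: "AE x in M. 0 \<le> U n x" for n using U by blast
  have U_le: "AE x in M. U n x \<le> B" for n using U by blast
  have U_Suc: "\<exists>g. poisson (rhs (U n)) (U (Suc n)) g" for n
    using step[OF U_meas[of n] U_le[of n]] by (simp add: U_def)
  have U_mono: "AE x in M. U n x \<le> U (Suc n) x" for n
  proof (induction n)
    case 0
    then show ?case using U_nonneg[of 1] by (simp add: U_def)
  next
    case (Suc n)
    obtain g g' where g: "poisson (rhs (U n)) (U (Suc n)) g" "poisson (rhs (U (Suc n))) (U (Suc (Suc n))) g'"
      using U_Suc by metis
    have "AE x in M. rhs (U n) x \<le> rhs (U (Suc n)) x"
      using Suc lam
      by eventually_elim (auto simp: rhs_def intro!: mult_left_mono monoD[OF f0_mono])
    then show ?case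
      by (intro poisson_mono[OF g] rhs_sq U_meas U_le)
  qed
  define L where "L x = lim (\<lambda>n. U n x)" for x
  have [measurable]: "L \<in> borel_measurable M"
    unfolding L_def by (intro borel_measurable_lim_metric) simp
  have lim: "AE x in M. (\<lambda>n. U n x) \<longlonglongrightarrow> L x \<and> (\<forall>n. 0 \<le> U n x \<and> U n x \<le> L x \<and> U n x \<le> B)"
  proof -
    have "AE x in M. \<forall>n. 0 \<le> U n x \<and> U n x \<le> B \<and> U n x \<le> U (Suc n) x"
      using U_nonneg U_le U_mono by (simp add: AE_all_countable)
    then show ?thesis
    proof eventually_elim
      case (elim x)
      have inc: "incseq (\<lambda>n. U n x)" using elim by (intro incseq_SucI) auto
      obtain l where l: "(\<lambda>n. U n x) \<longlonglongrightarrow> l"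
        using incseq_convergent[OF inc, of B] elim by blast
      then have "L x = l" by (simp add: L_def limI)
      with l incseq_le[OF inc l] elim show ?case by auto
    qed
  qed
  have L_le: "AE x in M. L x \<le> B"
    using lim by eventually_elim (auto intro: LIMSEQ_le_const2)
  have rhs_lim: "AE x in M. (\<lambda>n. rhs (U n) x) \<longlonglongrightarrow> rhs L x"
    using lim
  proof eventually_elim
    case (elim x)
    then have "0 \<le> U 0 x" "U 0 x \<le> L x" by auto
    then have "0 \<le> L x" by linarith
    then have "(\<lambda>n. f0 (U n x)) \<longlonglongrightarrow> f0 (L x)"
      using lsc_mono_tendsto[OF f_mono f_lsc, of "\<lambda>n. U n x" "L x"] elim by (simp add: f0_def)
    then show ?case unfolding rhs_def by (intro tendsto_intros)
  qed
  \<comment> \<open>The gradients of the iterates are not followed to the limit. The linear problem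
    with the limiting right-hand side is solved afresh, and its solution is shown to be L almost
    everywhere.\<close>
  obtain u g where ug: "poisson (rhs L) u g"
    using poisson_exists[OF rhs_sq[OF _ L_le]] by auto
  note u = sol[OF ug _ L_le]
  have [measurable]: "u \<in> borel_measurable M" using u(1) by simp
  have u_sq: "sq_int M u" using ug by (auto simp: poisson_def H10_def)
  have U_sq: "sq_int M (U n)" for n
  proof (rule fin.sq_int_bounded[of _ B])
    show "AE x in M. norm (U n x) \<le> B"
      using U_nonneg[of n] U_le[of n] by eventually_elim simp
  qed simp
  have L_sq: "sq_int M L"
  proof (rule fin.sq_int_bounded[of _ B])
    show "AE x in M. norm (L x) \<le> B"
      using L_le lim
    proof eventually_elim
      case (elim x)
      then have "0 \<le> U 0 x" "U 0 x \<le> L x" by auto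
      then have "0 \<le> L x" by linarith
      with elim(1) show ?case by simp
    qed
  qed simp
  have "AE x in M. L x = u x"
  proof -
    obtain C where C: "\<And>F F' u u' g g'. poisson F u g \<Longrightarrow> poisson F' u' g' \<Longrightarrow> sq_int M F \<Longrightarrow> sq_int M F'
      \<Longrightarrow> sq_norm M (\<lambda>x. u x - u' x) \<le> C * sq_norm M (\<lambda>x. F x - F' x)"
      using poisson_stable by blast
    have l1: "(\<lambda>n. sq_norm M (\<lambda>x. rhs (U n) x - rhs L x)) \<longlonglongrightarrow> 0"
      by (intro fin.tendsto_sq_norm_dominated[of _ _ A] rhs_abs rhs_lim rhs_meas U_meas U_le) simp
    have "(\<lambda>n. sq_norm M (\<lambda>x. U n x - L x)) \<longlonglongrightarrow> 0"
    proof (rule fin.tendsto_sq_norm_dominated[of _ _ B])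
      show "AE x in M. \<bar>U n x\<bar> \<le> B" for n
        using U_nonneg[of n] U_le[of n] by eventually_elim simp
      show "AE x in M. (\<lambda>n. U n x) \<longlonglongrightarrow> L x" using lim by auto
    qed auto
    \<comment> \<open>The shift matters because \<open>U (Suc n)\<close> is the solution belonging
      to \<open>rhs (U n)\<close>.\<close>
    then have l2: "(\<lambda>n. sq_norm M (\<lambda>x. U (Suc n) x - L x)) \<longlonglongrightarrow> 0"
      by (rule LIMSEQ_Suc)
    have "sq_norm M (\<lambda>x. L x - u x) \<le> 2 * (C * sq_norm M (\<lambda>x. rhs (U n) x - rhs L x))
        + 2 * sq_norm M (\<lambda>x. U (Suc n) x - L x)" for n
    proof -
      obtain g' where "poisson (rhs (U n)) (U (Suc n)) g'" using U_Suc by blast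
      then have "sq_norm M (\<lambda>x. U (Suc n) x - u x) \<le> C * sq_norm M (\<lambda>x. rhs (U n) x - rhs L x)"
        using ug L_le by (intro C rhs_sq U_meas U_le) auto
      moreover have "sq_norm M (\<lambda>x. L x - u x) \<le> 2 * sq_norm M (\<lambda>x. U (Suc n) x - u x)
          + 2 * sq_norm M (\<lambda>x. U (Suc n) x - L x)"
        using sq_norm_diff_le[OF sq_int_diff[OF U_sq u_sq] sq_int_diff[OF U_sq L_sq], of "Suc n" "Suc n"]
        by simp
      ultimately show ?thesis by linarith
    qed
    moreover have "(\<lambda>n. 2 * (C * sq_norm M (\<lambda>x. rhs (U n) x - rhs L x))
        + 2 * sq_norm M (\<lambda>x. U (Suc n) x - L x)) \<longlonglongrightarrow> 2 * (C * 0) + 2 * 0"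
      by (intro tendsto_add tendsto_mult tendsto_const l1 l2)
    ultimately have "sq_norm M (\<lambda>x. L x - u x) \<le> 2 * (C * 0) + 2 * 0"
      by (intro LIMSEQ_le_const) auto
    then have "sq_norm M (\<lambda>x. L x - u x) = 0"
      using sq_norm_nonneg[of M "\<lambda>x. L x - u x"] by linarith
    then have "AE x in M. (norm (L x - u x))\<^sup>2 = 0"
      using integral_nonneg_eq_0_iff_AE[OF sq_int_integrable[OF sq_int_diff[OF L_sq u_sq]]] by simp
    then show ?thesis by eventually_elim simp
  qed
  \<comment> \<open>u is nonnegative only almost everywhere. For this version f and f0 agree at u' x
    for every x, so the equation can be stated with f itself.\<close>
  define u' where "u' x = max 0 (u x)" for x
  have [measurable]: "u' \<in> borel_measurable M" unfolding u'_def by simp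
  have u'_u: "AE x in M. u x = u' x" using u(2) by (auto simp: u'_def elim!: eventually_mono)
  have u'_le: "AE x in M. u' x \<le> B"
    using u(3) \<open>0 \<le> B\<close> by (auto simp: u'_def elim!: eventually_mono)
  have rhs_eq: "AE x in M. rhs L x = rhs u' x"
    using \<open>AE x in M. L x = u x\<close> u'_u by eventually_elim (simp add: rhs_def)
  have "H10 u g" using ug by (simp add: poisson_def)
  then have H: "H10 u' g" by (rule H10_cong_AE) (simp, rule u'_u)
  have rhs': "rhs u' x = lam x * f (u' x) + h x" for x
    unfolding rhs_def f0_def u'_def by simp
  have "weak_solution \<Omega> lam f h u'"
    unfolding weak_solution_def set_integrable_iff_M set_integral_eq_M rhs'[symmetric]
  proof (intro exI[of _ g] conjI allI impI)
    show "W120 \<Omega> u' g" using H by (rule H10_imp_W120)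
    fix \<phi> assume \<phi>: "test_fun \<Omega> \<phi>"
    have sm: "smooth_fun \<phi>" using \<phi> by (rule test_fun_smooth)
    show "integrable M (\<lambda>x. g x \<bullet> grad \<phi> x)"
      using H sq_int_grad[OF sm] by (intro integrable_inner_sq_int) (auto simp: H10_def)
    show "integrable M (\<lambda>x. rhs u' x * \<phi> x)"
      using rhs_sq[OF _ u'_le] sm by (intro integrable_mult_test) auto
    have [measurable]: "\<phi> \<in> borel_measurable M" using sq_int_smooth[OF sm] by (simp add: sq_int_def)
    have "(LINT x|M. g x \<bullet> grad \<phi> x) = (LINT x|M. rhs L x * \<phi> x)"
      using ug \<phi> by (simp add: poisson_def)
    also have "\<dots> = (LINT x|M. rhs u' x * \<phi> x)"
      by (rule integral_cong_AE) (use rhs_eq in \<open>auto elim!: eventually_mono\<close>)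
    finally show "(LINT x|M. g x \<bullet> grad \<phi> x) = (LINT x|M. rhs u' x * \<phi> x)" .
  qed
  then show ?thesis
    using u'_le by (intro that[of u']) (auto simp: u'_def)
qed

end

section \<open>Choice of the bound from the growth of f\<close>

lemma sublinear_bound_exists:
  fixes p q r :: real
  assumes "p < 1" "0 \<le> q" "0 \<le> r"
  obtains B where "B \<ge> 1" "q * B powr p + r \<le> B"
proof -
  \<comment> \<open>Each summand is to be at most B/2: this is \<open>2 * r \<le> B\<close> for the
    constant one, and B^(1-p) \<ge> 2 q for the power.\<close>
  define B where "B = max 1 (max (2 * r) ((2 * q) powr (1 / (1 - p))))"
  have B: "B \<ge> 1" "B \<ge> 2 * r" "B \<ge> (2 * q) powr (1 / (1 - p))" by (auto simp: B_def)
  have "2 * q \<le> ((2 * q) powr (1 / (1 - p))) powr (1 - p)"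
    using assms by (simp add: powr_powr)
  also have "\<dots> \<le> B powr (1 - p)"
    using B assms by (intro powr_mono2) auto
  finally have "2 * q * B powr p \<le> B powr (1 - p) * B powr p"
    by (intro mult_right_mono) auto
  also have "\<dots> = B" using B by (simp flip: powr_add)
  finally show ?thesis using B by (intro that[of B]) auto
qed

theorem theorem3p3:
  fixes \<Omega> :: "'a::euclidean_space set"
    and f :: "real \<Rightarrow> real" and lam h :: "'a \<Rightarrow> real" and K p :: real
  assumes f_nonneg: "\<And>s. s \<ge> 0 \<Longrightarrow> f s \<ge> 0"
    and f_mono: "\<And>s t. 0 \<le> s \<Longrightarrow> s \<le> t \<Longrightarrow> f s \<le> f t"
    and f_lsc: "lsc_nonneg f"
    and K_pos: "K > 0" and p_pos: "p > 0"
    and f_growth: "\<And>s. s \<ge> 0 \<Longrightarrow> f s \<le> K * s powr p"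
    and \<Omega>_open: "open \<Omega>" and \<Omega>_conn: "connected \<Omega>" and \<Omega>_ne: "\<Omega> \<noteq> {}"
    and \<Omega>_bdd: "bounded \<Omega>" and \<Omega>_C11: "C11_domain \<Omega>"
    and h_Linf: "Linf_on \<Omega> h" and lam_Linf: "Linf_on \<Omega> lam"
    and h_nonneg: "AE x in lebesgue. x \<in> \<Omega> \<longrightarrow> h x \<ge> 0"
    and lam_nonneg: "AE x in lebesgue. x \<in> \<Omega> \<longrightarrow> lam x \<ge> 0"
  shows
    "(p < 1 \<longrightarrow>
        (\<exists>u. weak_solution \<Omega> lam f h u \<and> Linf_on \<Omega> u
             \<and> (AE x in lebesgue. x \<in> \<Omega> \<longrightarrow> u x \<ge> 0)))
   \<and> (p \<ge> 1 \<and> (slab_diam \<Omega>)\<^sup>2 / 8 * K * Linf_norm \<Omega> lam \<le> 1/2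
        \<and> Linf_norm \<Omega> h \<le> Linf_norm \<Omega> lam * K \<longrightarrow>
        (\<exists>u. weak_solution \<Omega> lam f h u \<and> Linf_on \<Omega> u
             \<and> (AE x in lebesgue. x \<in> \<Omega> \<longrightarrow> u x \<ge> 0)
             \<and> Linf_norm \<Omega> u \<le> 1))"
proof -
  interpret bounded_open_set \<Omega>
    using \<Omega>_open \<Omega>_bdd by unfold_locales
  define \<Lambda> H c where "\<Lambda> = Linf_norm \<Omega> lam" and "H = Linf_norm \<Omega> h" and "c = (slab_diam \<Omega>)\<^sup>2 / 8"
  have nonneg: "0 \<le> \<Lambda>" "0 \<le> H" "0 \<le> c"
    using Linf_norm_nonneg[OF \<Omega>_ne] lam_Linf h_Linf by (auto simp: \<Lambda>_def H_def c_def)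
  have lam: "AE x in M. 0 \<le> lam x \<and> lam x \<le> \<Lambda>"
    using AE_le_Linf_norm[OF lam_Linf] lam_nonneg[folded AE_M_iff]
    by eventually_elim (auto simp: \<Lambda>_def)
  have h: "AE x in M. 0 \<le> h x \<and> h x \<le> H"
    using AE_le_Linf_norm[OF h_Linf] h_nonneg[folded AE_M_iff]
    by eventually_elim (auto simp: H_def)
  have solve: "\<exists>u. weak_solution \<Omega> lam f h u \<and> Linf_on \<Omega> u
      \<and> (AE x in lebesgue. x \<in> \<Omega> \<longrightarrow> u x \<ge> 0) \<and> Linf_norm \<Omega> u \<le> B"
    if "0 \<le> B" and B: "(\<Lambda> * f B + H) * c \<le> B" for B
  proof -
    obtain u where u: "weak_solution \<Omega> lam f h u" "u \<in> borel_measurable M" "\<And>x. 0 \<le> u x" "AE x in M. u x \<le> B"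
      using semilinear_exists[OF \<Omega>_ne f_nonneg f_mono f_lsc _ _ lam h nonneg(1,2) \<open>0 \<le> B\<close>]
        B lam_Linf h_Linf by (auto simp: c_def Linf_on_def)
    have ae: "AE x in M. \<bar>u x\<bar> \<le> B" using u by simp
    then have "Linf_on \<Omega> u" using u(2) by (auto simp: Linf_on_def AE_M_iff)
    then show ?thesis using u Linf_norm_le[OF \<Omega>_ne ae] by auto
  qed
  \<comment> \<open>The growth condition is evaluated at the single point B, since monotonicity has
    already reduced the values of f on [0, B] to f B.\<close>
  have bound: "(\<Lambda> * f B + H) * c \<le> (\<Lambda> * (K * B powr p) + H) * c" if "0 \<le> B" for B
    using f_growth[OF that] nonneg by (intro mult_right_mono add_right_mono mult_left_mono) auto
  show ?thesis
  proof (intro conjI impI)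
    assume "p < 1"
    then obtain B where B: "B \<ge> 1" "\<Lambda> * K * c * B powr p + H * c \<le> B"
      using sublinear_bound_exists[of p "\<Lambda> * K * c" "H * c"] nonneg K_pos by auto
    then have "(\<Lambda> * f B + H) * c \<le> B"
      using bound[of B] by (simp add: algebra_simps)
    with B show "\<exists>u. weak_solution \<Omega> lam f h u \<and> Linf_on \<Omega> u
        \<and> (AE x in lebesgue. x \<in> \<Omega> \<longrightarrow> u x \<ge> 0)"
      using solve[of B] by auto
  next
    assume *: "p \<ge> 1 \<and> (slab_diam \<Omega>)\<^sup>2 / 8 * K * Linf_norm \<Omega> lam \<le> 1/2
        \<and> Linf_norm \<Omega> h \<le> Linf_norm \<Omega> lam * K"
    \<comment> \<open>B = 1 makes the power equal to 1 for every p. The two smallness conditions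
      then give 2 c K \<Lambda> \<le> 1, half from f and half from h.\<close>
    then have "(\<Lambda> * (K * 1 powr p) + H) * c \<le> (\<Lambda> * K + \<Lambda> * K) * c"
      using nonneg by (intro mult_right_mono) (simp_all add: \<Lambda>_def H_def mult.commute)
    also have "\<dots> \<le> 1" using * by (simp add: \<Lambda>_def c_def algebra_simps)
    finally show "\<exists>u. weak_solution \<Omega> lam f h u \<and> Linf_on \<Omega> u
        \<and> (AE x in lebesgue. x \<in> \<Omega> \<longrightarrow> u x \<ge> 0) \<and> Linf_norm \<Omega> u \<le> 1"
      using bound[of 1] by (intro solve) auto
  qed
qed

end
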